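(* Let $X$ be a partially multiplicative biquandle. The number of $X$-colorings of a $Y$-oriented spatial trivalent graph diagram representing an $S^1$-oriented handlebody-knot is invariant under the handlebody-knot Reidemeister moves; that is, if $\Gamma$ and $\Gamma'$ are $Y$-oriented spatial trivalent graph diagrams related by a handlebody-knot Reidemeister move, then $\Gamma$ and $\Gamma'$ have the same number of $X$-colorings.
   Context: A biquandle is a set $X$ with maps $\underline{\triangleright},\overline{\triangleright}:X\times X\to X$ such that: (i) $x\,\underline{\triangleright}\,x=x\,\overline{\triangleright}\,x$ for all $x$; (ii) for each $y\in X$ the maps $x\mapsto x\,\overline{\triangleright}\,y$ and $x\mapsto x\,\underline{\triangleright}\,y$ are bijections $X\to X$, and $S(x,y)=(y\,\overline{\triangleright}\,x,\ x\,\underline{\triangleright}\,y)$ is a bijection $X\times X\to X\times X$; (iii) for all $x,y,z$: $(x\,\underline{\triangleright}\,y)\,\underline{\triangleright}\,(z\,\underline{\triangleright}\,y)=(x\,\underline{\triangleright}\,z)\,\underline{\triangleright}\,(y\,\overline{\triangleright}\,z)$, $(x\,\underline{\triangleright}\,y)\,\overline{\triangleright}\,(z\,\underline{\triangleright}\,y)=(x\,\overline{\triangleright}\,z)\,\underline{\triangleright}\,(y\,\overline{\triangleright}\,z)$, $(x\,\overline{\triangleright}\,y)\,\overline{\triangleright}\,(z\,\overline{\triangleright}\,y)=(x\,\overline{\triangleright}\,z)\,\overline{\triangleright}\,(y\,\underline{\triangleright}\,z)$. A partially multiplicative biquandle is a biquandle $X$ with a subset $D\subset X\times X$ and a map $D\to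 X$, $(a,b)\mapsto ab$, such that for all elements of $X$: (i) for each fixed $a$ the partial map $x\mapsto ax$, and for each fixed $b$ the partial map $x\mapsto xb$, are injective on their domains; (ii) $(a,b\,\underline{\triangleright}\,a)\in D\Leftrightarrow(b,a\,\overline{\triangleright}\,b)\in D$, and in this case $a(b\,\underline{\triangleright}\,a)=b(a\,\overline{\triangleright}\,b)$; (iii) $(a,b)\in D\Leftrightarrow(a\,\underline{\triangleright}\,x,\,b\,\underline{\triangleright}\,(x\,\overline{\triangleright}\,a))\in D\Leftrightarrow(a\,\overline{\triangleright}\,x,\,b\,\overline{\triangleright}\,(x\,\underline{\triangleright}\,a))\in D$, and in this case $x\,\underline{\triangleright}\,(ab)=(x\,\underline{\triangleright}\,a)\,\underline{\triangleright}\,b$, $(ab)\,\underline{\triangleright}\,x=(a\,\underline{\triangleright}\,x)(b\,\underline{\triangleright}\,(x\,\overline{\triangleright}\,a))$, $x\,\overline{\triangleright}\,(ab)=(x\,\overline{\triangleright}\,a)\,\overline{\triangleright}\,b$, $(ab)\,\overline{\triangleright}\,x=(a\,\overline{\triangleright}\,x)(b\,\overline{\triangleright}\,(x\,\underline{\triangleright}\,a))$; (iv) $(a,b),(ab,c)\in D\Leftrightarrow(b,c),(a,bc)\in D$, and in this case $(ab)c=a(bc)$; (v) [$(a,b),(c,d)\in D$ and $ab=cd$] $\Leftrightarrow$ there exists $e\in X$ with $(a,e),(e,d)\in D$, $ae=c$, $ed=b$. A spatial trivalent graph diagram is a regular planar diagram, with over/under crossing information, of a finite trivalent graph (circle components allowed)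 embedded in 3-space; it represents the handlebody-knot given by a regular neighborhood of the graph. A $Y$-orientation is a choice of direction of every edge such that no vertex is a source or a sink; an $S^1$-orientation of a handlebody-knot corresponds to a $Y$-orientation of a representing spatial trivalent graph. Semiarcs are the portions of the diagram between consecutive under-crossing points, over-crossing points and vertices. An $X$-coloring of a $Y$-oriented diagram assigns an element of $X$ to each semiarc such that: - at each crossing, if $x$ is the color of the under-strand semiarc lying to the right of the (oriented) over-strand, and $y$ is the color of the over-strand semiarc lying to the right of the (oriented) under-strand, then the under-strand semiarc to the left of the over-strand has color $x\,\underline{\triangleright}\,y$ and the over-strand semiarc to the left of the under-strand has color $y\,\overline{\triangleright}\,x$; - at each vertex, two of the three edges are both incoming or both outgoing; drawing the vertex locally so that all three edges point upward, if the right one and the left one of these two edges have colors $a$ and $b$ respectively, then $(a,b)\in D$ and the third edge has color $ab$. The handlebody-knot Reidemeister moves, each supported in a disc with both sides $Y$-oriented compatibly with the orientation outside the disc, are: the classical Reidemeister moves I, II, III; moving a strand across a vertex, passing entirely over or entirely under it; adding or removing a crossing between two of the edges adjacent to a vertex (twisting the two edges around each other at the vertex); and the IH move, which replaces two vertices joined by a crossingless edge in a disc with four boundary points by the other planar trivalent tree with one internal edge on the same four boundary points. *)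

theory Defs
  imports "HOL-Library.FuncSet" "HOL-Library.Equipollence"
begin

section \<open>Partially multiplicative biquandles\<close>

text \<open>\<open>x \<unrhd> y\<close> is the operation with underlined triangle, \<open>x \<rhd> y\<close> the one with overlined triangle.\<close>

locale biquandle =
  fixes utri :: "'x \<Rightarrow> 'x \<Rightarrow> 'x"  (infixl "\<unrhd>" 70)
    and otri :: "'x \<Rightarrow> 'x \<Rightarrow> 'x"  (infixl "\<rhd>" 70)
  assumes diagonal: "x \<unrhd> x = x \<rhd> x"
    and bij_over: "bij (\<lambda>x. x \<rhd> y)"
    and bij_under: "bij (\<lambda>x. x \<unrhd> y)"
    and bij_S: "bij (\<lambda>(x, y). (y \<rhd> x, x \<unrhd> y))"
    and exchange1: "(x \<unrhd> y) \<unrhd> (z \<unrhd> y) = (x \<unrhd> z) \<unrhd> (y \<rhd> z)"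
    and exchange2: "(x \<unrhd> y) \<rhd> (z \<unrhd> y) = (x \<rhd> z) \<unrhd> (y \<rhd> z)"
    and exchange3: "(x \<rhd> y) \<rhd> (z \<rhd> y) = (x \<rhd> z) \<rhd> (y \<unrhd> z)"

text \<open>The partial product is a total function \<open>\<odot>\<close> together with its domain \<open>D\<close>; its values
  outside \<open>D\<close> are never used.\<close>

locale partially_multiplicative_biquandle = biquandle utri otri
  for utri :: "'x \<Rightarrow> 'x \<Rightarrow> 'x"  (infixl "\<unrhd>" 70)
    and otri :: "'x \<Rightarrow> 'x \<Rightarrow> 'x"  (infixl "\<rhd>" 70) +
  fixes D :: "('x \<times> 'x) set"
    and mult :: "'x \<Rightarrow> 'x \<Rightarrow> 'x"  (infixl "\<odot>" 75)
  assumes inj_left: "inj_on (\<lambda>x. a \<odot> x) {x. (a, x) \<in> D}"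
    and inj_right: "inj_on (\<lambda>x. x \<odot> b) {x. (x, b) \<in> D}"
    and twist_dom: "(a, b \<unrhd> a) \<in> D \<longleftrightarrow> (b, a \<rhd> b) \<in> D"
    and twist: "(a, b \<unrhd> a) \<in> D \<Longrightarrow> a \<odot> (b \<unrhd> a) = b \<odot> (a \<rhd> b)"
    and act_dom_under: "(a, b) \<in> D \<longleftrightarrow> (a \<unrhd> x, b \<unrhd> (x \<rhd> a)) \<in> D"
    and act_dom_over: "(a, b) \<in> D \<longleftrightarrow> (a \<rhd> x, b \<rhd> (x \<unrhd> a)) \<in> D"
    and under_mult: "(a, b) \<in> D \<Longrightarrow> x \<unrhd> (a \<odot> b) = (x \<unrhd> a) \<unrhd> b"
    and mult_under: "(a, b) \<in> D \<Longrightarrow> (a \<odot> b) \<unrhd> x = (a \<unrhd> x) \<odot> (b \<unrhd> (x \<rhd> a))"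
    and over_mult: "(a, b) \<in> D \<Longrightarrow> x \<rhd> (a \<odot> b) = (x \<rhd> a) \<rhd> b"
    and mult_over: "(a, b) \<in> D \<Longrightarrow> (a \<odot> b) \<rhd> x = (a \<rhd> x) \<odot> (b \<rhd> (x \<unrhd> a))"
    and assoc_dom: "(a, b) \<in> D \<and> (a \<odot> b, c) \<in> D \<longleftrightarrow> (b, c) \<in> D \<and> (a, b \<odot> c) \<in> D"
    and assoc: "(a, b) \<in> D \<Longrightarrow> (a \<odot> b, c) \<in> D \<Longrightarrow> (a \<odot> b) \<odot> c = a \<odot> (b \<odot> c)"
    and interchange: "(a, b) \<in> D \<and> (c, d) \<in> D \<and> a \<odot> b = c \<odot> d \<longleftrightarrow>
      (\<exists>e. (a, e) \<in> D \<and> (e, d) \<in> D \<and> a \<odot> e = c \<and> e \<odot> d = b)"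

section \<open>Y-oriented spatial trivalent graph diagrams\<close>

text \<open>A diagram is encoded, up to planar isotopy, by its oriented planar-diagram code: a finite set
  of labelled, directed semiarcs, and for every crossing and every vertex the labels of the
  semiarcs met when going around it.

  \<^item> \<open>Crossing i r j l s\<close>: the under-strand runs from \<open>i\<close> to \<open>j\<close>; the over-strand consists of \<open>r\<close>, to
    the right of the under-strand, and \<open>l\<close>, to its left. It runs from \<open>r\<close> to \<open>l\<close> if \<open>s\<close> holds and
    from \<open>l\<close> to \<open>r\<close> otherwise. The counterclockwise order is \<open>i, r, j, l\<close>.
  \<^item> \<open>Vertex p q r d\<close>: \<open>p, q, r\<close> in counterclockwise order. If \<open>d\<close> holds, \<open>p\<close> and \<open>q\<close> are incoming and
    \<open>r\<close> is outgoing; otherwise \<open>p\<close> and \<open>q\<close> are outgoing and \<open>r\<close> is incoming. So a vertex is never a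
    source or a sink.

  A semiarc that occurs in no node is a circle component without crossings.\<close>

datatype 'e node =
    Crossing 'e 'e 'e 'e bool
  | Vertex 'e 'e 'e bool

record diagram =
  semiarcs :: "nat set"
  nodes :: "nat node set"

text \<open>The semiarc ends at a node in counterclockwise order; the flag tells whether the semiarc is
  directed into the node there.\<close>

fun ends :: "'e node \<Rightarrow> ('e \<times> bool) list" where
  "ends (Crossing i r j l s) = [(i, True), (r, s), (j, False), (l, \<not> s)]"
| "ends (Vertex p q r d) = [(p, d), (q, d), (r, \<not> d)]"

definition darts :: "'e node set \<Rightarrow> ('e \<times> bool) set" where
  "darts N = (\<Union>n\<in>N. set (ends n))"

definition equiv_closure :: "('a \<times> 'a) set \<Rightarrow> ('a \<times> 'a) set" where
  "equiv_closure r = (r \<union> r\<inverse>)\<^sup>*"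

definition turn :: "'e node set \<Rightarrow> (('e \<times> bool) \<times> ('e \<times> bool)) set" where
  "turn N = (\<Union>n\<in>N. set (zip (ends n) (rotate1 (ends n))))"

definition flip :: "(('e \<times> bool) \<times> ('e \<times> bool)) set" where
  "flip = {((e, d), (e, \<not> d)) |e d. True}"

text \<open>The regions around each component are the orbits of ``go to the other end of the semiarc, then
  turn''. Planarity is Euler's formula V + F = E + 2C (a component of positive genus would
  make the left-hand side smaller).\<close>

definition faces :: "'e node set \<Rightarrow> ('e \<times> bool) set set" where
  "faces N = darts N // equiv_closure (flip O turn N)"

definition components :: "'e node set \<Rightarrow> ('e \<times> bool) set set" where
  "components N = darts N // equiv_closure (flip \<union> turn N)"

definition planar :: "'e node set \<Rightarrow> bool" where
  "planar N \<longleftrightarrow>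
     card N + card (faces N) = card (fst ` darts N) + 2 * card (components N)"

definition is_diagram :: "diagram \<Rightarrow> bool" where
  "is_diagram \<Gamma> \<longleftrightarrow>
     finite (semiarcs \<Gamma>) \<and> finite (nodes \<Gamma>) \<and>
     (\<forall>n\<in>nodes \<Gamma>. distinct (ends n)) \<and>
     (\<forall>n\<in>nodes \<Gamma>. \<forall>n'\<in>nodes \<Gamma>. n \<noteq> n' \<longrightarrow> set (ends n) \<inter> set (ends n') = {}) \<and>
     (\<forall>(e, d)\<in>darts (nodes \<Gamma>). e \<in> semiarcs \<Gamma> \<and> (e, \<not> d) \<in> darts (nodes \<Gamma>)) \<and>
     planar (nodes \<Gamma>)"

section \<open>Colorings\<close>

text \<open>At a crossing, \<open>j\<close> lies to the right of the over-strand if the latter runs from \<open>r\<close> to \<open>l\<close>, and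
  \<open>i\<close> does otherwise. At a vertex drawn with all edges pointing upward, \<open>p\<close> is the left one of the
  two like edges if they are incoming and the right one if they are outgoing.\<close>

fun node_coloring :: "('x \<Rightarrow> 'x \<Rightarrow> 'x) \<Rightarrow> ('x \<Rightarrow> 'x \<Rightarrow> 'x) \<Rightarrow> ('x \<times> 'x) set \<Rightarrow> ('x \<Rightarrow> 'x \<Rightarrow> 'x) \<Rightarrow>
    ('e \<Rightarrow> 'x) \<Rightarrow> 'e node \<Rightarrow> bool" where
  "node_coloring utri otri D mult c (Crossing i r j l s) \<longleftrightarrow>
     (let (x, x') = (if s then (c j, c i) else (c i, c j)); y = c r
      in x' = utri x y \<and> c l = otri y x)"
| "node_coloring utri otri D mult c (Vertex p q r d) \<longleftrightarrow>
     (let (a, b) = (if d then (c q, c p) else (c p, c q))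
      in (a, b) \<in> D \<and> c r = mult a b)"

definition colorings :: "('x \<Rightarrow> 'x \<Rightarrow> 'x) \<Rightarrow> ('x \<Rightarrow> 'x \<Rightarrow> 'x) \<Rightarrow> ('x \<times> 'x) set \<Rightarrow> ('x \<Rightarrow> 'x \<Rightarrow> 'x) \<Rightarrow>
    diagram \<Rightarrow> (nat \<Rightarrow> 'x) set" where
  "colorings utri otri D mult \<Gamma> =
     {c \<in> semiarcs \<Gamma> \<rightarrow>\<^sub>E UNIV. \<forall>n\<in>nodes \<Gamma>. node_coloring utri otri D mult c n}"

section \<open>Handlebody-knot Reidemeister moves\<close>

text \<open>\<open>crossing h e1 e2 e3 e4 p q\<close>: a crossing with ends \<open>e1, e2, e3, e4\<close> in counterclockwise order,
  in which the strand joining \<open>e1\<close> and \<open>e3\<close> is the under-strand iff \<open>h\<close>. The strand joining \<open>e1\<close> and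
  \<open>e3\<close> runs from \<open>e1\<close> to \<open>e3\<close> iff \<open>p\<close>, and the other one from \<open>e2\<close> to \<open>e4\<close> iff \<open>q\<close>.\<close>

fun under_crossing :: "'e \<Rightarrow> 'e \<Rightarrow> 'e \<Rightarrow> 'e \<Rightarrow> bool \<Rightarrow> bool \<Rightarrow> 'e node" where
  "under_crossing e1 e2 e3 e4 p q =
     (if p then Crossing e1 e2 e3 e4 q else Crossing e3 e4 e1 e2 (\<not> q))"

fun crossing :: "bool \<Rightarrow> 'e \<Rightarrow> 'e \<Rightarrow> 'e \<Rightarrow> 'e \<Rightarrow> bool \<Rightarrow> bool \<Rightarrow> 'e node" where
  "crossing h e1 e2 e3 e4 p q =
     (if h then under_crossing e1 e2 e3 e4 p q else under_crossing e2 e3 e4 e1 q (\<not> p))"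

text \<open>A vertex with its three ends in counterclockwise order; a flag is true if the edge is incoming.
  Meaningful only if \<open>no_source_sink\<close> holds for the three flags.\<close>

fun vertex :: "'e \<times> bool \<Rightarrow> 'e \<times> bool \<Rightarrow> 'e \<times> bool \<Rightarrow> 'e node" where
  "vertex (e1, d1) (e2, d2) (e3, d3) =
     (if d1 = d2 then Vertex e1 e2 e3 d1
      else if d2 = d3 then Vertex e2 e3 e1 d2
      else Vertex e3 e1 e2 d3)"

definition no_source_sink :: "bool \<Rightarrow> bool \<Rightarrow> bool \<Rightarrow> bool" where
  "no_source_sink d1 d2 d3 \<longleftrightarrow> \<not> (d1 = d2 \<and> d2 = d3)"

text \<open>The part of a diagram inside a disc. A strand through the disc that meets no crossing or vertex
  is given by the pair of its two boundary labels in \<open>through\<close>; \<open>interior\<close> contains the semiarcs not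
  meeting the boundary of the disc.\<close>

record tangle =
  interior :: "nat set"
  inner_nodes :: "nat node set"
  through :: "(nat \<times> nat) set"

text \<open>The two sides of each move, with the same labels at the boundary of the disc. The flags \<open>d...\<close>
  range over all directions of the strands and edges, the flags \<open>h\<close> and \<open>h'\<close> over all crossing types:

  \<^item> R1: a kink on a strand from \<open>a\<close> to \<open>b\<close>.
  \<^item> R2: two vertical strands, from \<open>a1\<close> up to \<open>a3\<close> on the left and from \<open>b1\<close> up to \<open>b3\<close> on the right.
  \<^item> R3: a horizontal strand, from \<open>t1\<close> on the left to \<open>t3\<close> on the right, moves from below to above the
    crossing of a strand from \<open>a1\<close> (bottom left) to \<open>a3\<close> (top right) and one from \<open>b1\<close> (bottom right)
    to \<open>b3\<close> (top left). It passes over both of them if \<open>h'\<close> and under both of them otherwise.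
  \<^item> twist: the edges \<open>a\<close> (bottom left) and \<open>b\<close> (bottom right) at a vertex with third edge \<open>c\<close> (top).
  \<^item> pass: a horizontal strand from \<open>t1\<close> to \<open>t3\<close> moves from below to above a vertex with edges \<open>a1\<close>
    (bottom left), \<open>b1\<close> (bottom right), \<open>c1\<close> (top); over if \<open>h\<close>, under otherwise.
  \<^item> IH: boundary points \<open>w, x, y, z\<close> at bottom left, bottom right, top right, top left; the internal
    edge \<open>k\<close> is vertical on one side and horizontal on the other. Its direction on either side is
    any one for which no vertex is a source or a sink.

  In R1, R2 and R3 \<open>da, db, dt\<close> say that the strand runs from \<open>a\<close> to \<open>b\<close>, upward, or from left
  to right. At the vertices \<open>da, db, dc, dw, dx, dy, dz\<close> say that the edge points into the disc.\<close>

inductive move_sides :: "tangle \<Rightarrow> tangle \<Rightarrow> bool" where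
  R1: "move_sides
      \<lparr>interior = {k}, inner_nodes = {crossing h a k k b da da}, through = {}\<rparr>
      \<lparr>interior = {}, inner_nodes = {}, through = {(a, b)}\<rparr>"
| R2: "distinct [a2, b2] \<Longrightarrow> move_sides
      \<lparr>interior = {a2, b2},
       inner_nodes = {crossing h b1 a2 b2 a1 db (\<not> da), crossing h b2 a2 b3 a3 db da},
       through = {}\<rparr>
      \<lparr>interior = {}, inner_nodes = {}, through = {(a1, a3), (b1, b3)}\<rparr>"
| R3: "distinct [a2, b2, t2] \<Longrightarrow> move_sides
      \<lparr>interior = {a2, b2, t2},
       inner_nodes = {crossing h' a1 t2 a2 t1 da (\<not> dt), crossing h' b1 t3 b2 t2 db (\<not> dt),
         crossing h a2 b2 a3 b3 da db},
       through = {}\<rparr>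
      \<lparr>interior = {a2, b2, t2},
       inner_nodes = {crossing h a1 b1 a2 b2 da db, crossing h' b2 t2 b3 t1 db (\<not> dt),
         crossing h' a2 t3 a3 t2 da (\<not> dt)},
       through = {}\<rparr>"
| twist: "distinct [a2, b2] \<Longrightarrow> no_source_sink da db dc \<Longrightarrow> move_sides
      \<lparr>interior = {a2, b2},
       inner_nodes = {crossing h a b a2 b2 da db, vertex (b2, db) (a2, da) (c, dc)},
       through = {}\<rparr>
      \<lparr>interior = {}, inner_nodes = {vertex (a, da) (b, db) (c, dc)}, through = {}\<rparr>"
| pass: "distinct [a2, b2, t2] \<Longrightarrow> no_source_sink da db dc \<Longrightarrow> move_sides
      \<lparr>interior = {a2, b2, t2},
       inner_nodes = {crossing h a1 t2 a2 t1 da (\<not> dt), crossing h b1 t3 b2 t2 db (\<not> dt),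
         vertex (a2, da) (b2, db) (c1, dc)},
       through = {}\<rparr>
      \<lparr>interior = {c2},
       inner_nodes = {vertex (a1, da) (b1, db) (c2, dc), crossing h c2 t3 c1 t1 (\<not> dc) (\<not> dt)},
       through = {}\<rparr>"
| IH: "no_source_sink dw dx (\<not> up) \<Longrightarrow> no_source_sink up dy dz \<Longrightarrow>
     no_source_sink dw (\<not> right) dz \<Longrightarrow> no_source_sink right dx dy \<Longrightarrow> move_sides
      \<lparr>interior = {k},
       inner_nodes = {vertex (w, dw) (x, dx) (k, \<not> up), vertex (k, up) (y, dy) (z, dz)},
       through = {}\<rparr>
      \<lparr>interior = {k},
       inner_nodes = {vertex (w, dw) (k, \<not> right) (z, dz), vertex (k, right) (x, dx) (y, dy)},
       through = {}\<rparr>"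

text \<open>\<open>\<Gamma>\<close> is obtained by gluing the tangle \<open>T\<close> into the complement of a disc, which has nodes \<open>N\<close>
  and (pieces of) semiarcs \<open>L\<close>. The relabelling \<open>f\<close> identifies exactly the pieces that the
  crossingless strands of \<open>T\<close> join to one semiarc; in particular it is injective if there are none.\<close>

definition is_glued :: "nat set \<Rightarrow> nat node set \<Rightarrow> tangle \<Rightarrow> (nat \<Rightarrow> nat) \<Rightarrow> diagram \<Rightarrow> bool" where
  "is_glued L N T f \<Gamma> \<longleftrightarrow>
     interior T \<inter> L = {} \<and> inner_nodes T \<inter> N = {} \<and> through T \<subseteq> L \<times> L \<and>
     (\<forall>n\<in>N. set_node n \<subseteq> L) \<and> (\<forall>n\<in>inner_nodes T. set_node n \<subseteq> L \<union> interior T) \<and>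
     semiarcs \<Gamma> = f ` (L \<union> interior T) \<and>
     nodes \<Gamma> = map_node f ` (N \<union> inner_nodes T) \<and>
     (\<forall>u\<in>L \<union> interior T. \<forall>v\<in>L \<union> interior T. f u = f v \<longleftrightarrow> (u, v) \<in> equiv_closure (through T))"

text \<open>In each move one side is connected, so for planar diagrams \<open>\<Gamma>\<close> and \<open>\<Gamma>'\<close> the replacement
  takes place in a disc.\<close>

definition reidemeister_move :: "diagram \<Rightarrow> diagram \<Rightarrow> bool" where
  "reidemeister_move \<Gamma> \<Gamma>' \<longleftrightarrow>
     (\<exists>L N T T' f f'. (move_sides T T' \<or> move_sides T' T) \<and>
        is_glued L N T f \<Gamma> \<and> is_glued L N T' f' \<Gamma>')"

end

theory Submission
  imports Defs
begin

text \<open>A move replaces a tangle in a disc by another tangle with the same boundary, so a coloring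
  of either diagram is a coloring of the common part outside the disc together with a coloring of a
  tangle. The numbers of colorings agree because, for both tangles of a move, a coloring is determined
  by the colors on the boundary (\<open>rigid\<close>), and the two tangles admit the same colors on the
  boundary (\<open>extends_over\<close>). Then both sets of colorings are in bijection with one and the
  same set of colorings of the outside; this is \<open>colorings_eqpoll\<close>.

  What remains is algebra for each move, and the point is to survive all choices of directions. At a
  crossing the four colors satisfy a relation, \<open>sided_cross\<close>, in which two colors on
  adjacent semiarcs determine the other two; a change of direction only changes which of the four ends
  counts as lying on the right. This gives the second Reidemeister move at once. For the first one, the
  map \<open>S\<close> has to restrict to a bijection of the diagonal, which follows from the exchange
  laws (\<open>S_diagonal\<close>). For the third one, the twelve colors that three strands can take on
  the two sides of the move label the edges of a cube whose six faces are the crossings. The exchange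
  laws say that the faces fit together, and the two sides of the move are the two halves of the cube
  around opposite corners (\<open>sided_cross_cube\<close>); the directions only select the pair of
  corners.

  Passing a strand across a vertex rests on the compatibility of the triangle operations with the
  partial product, and the twist on the axiom for like edges that cross
  (\<open>product_commute\<close>), which becomes \<open>product_twist\<close> when one of the crossing
  edges carries the product. For the IH move, associativity and the interchange axiom are precisely the
  required statements, unless incoming and outgoing edges alternate around the disc. In that case one
  needs inverses, and they exist: the twist and interchange axioms make every factor of a product
  invertible (\<open>inverse_exists\<close>), as in a groupoid.

  Finally, a boundary point of a tangle could a priori carry the label of an interior semiarc. This
  would use up an end of that semiarc twice, which is impossible in a diagram as long as the nodes of
  the tangle are different from each other. Coinciding nodes are excluded by the directions of the strands or by
  the other side of the move (\<open>R3_boundary\<close>, \<open>pass_boundary\<close>, \<open>IH_boundary\<close>).\<close>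

section \<open>Colors at a crossing\<close>

context biquandle
begin

text \<open>Exchanging the two operations of a biquandle gives a biquandle again, with mirrored
  crossings. A flag for the operation lets one proof cover a statement and its mirror image.\<close>

definition tri :: "bool \<Rightarrow> 'x \<Rightarrow> 'x \<Rightarrow> 'x" where
  "tri h x y = (if h then x \<unrhd> y else x \<rhd> y)"

text \<open>The colors \<open>x\<close> and \<open>y\<close> of two strands on the right of each other
  become \<open>x'\<close> and \<open>y'\<close> on the left; the strand of \<open>x\<close> is the
  lower one iff \<open>h\<close>.\<close>

definition cross :: "bool \<Rightarrow> 'x \<Rightarrow> 'x \<Rightarrow> 'x \<Rightarrow> 'x \<Rightarrow> bool" where
  "cross h x y x' y' \<longleftrightarrow> x' = tri h x y \<and> y' = tri (\<not> h) y x"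

text \<open>The same relation when the semiarcs are named by their position in the plane: the one
  colored \<open>x\<close> lies on the right of the other strand iff \<open>s\<close>, the one colored
  \<open>y\<close> iff \<open>r\<close>.\<close>

definition sided_cross :: "bool \<Rightarrow> bool \<Rightarrow> bool \<Rightarrow> 'x \<Rightarrow> 'x \<Rightarrow> 'x \<Rightarrow> 'x \<Rightarrow> bool" where
  "sided_cross h s r x x' y y' \<longleftrightarrow>
     cross h (if s then x else x') (if r then y else y') (if s then x' else x) (if r then y' else y)"

lemma cross_swap: "cross h x y x' y' \<longleftrightarrow> cross (\<not> h) y x y' x'"
  by (auto simp: cross_def tri_def)

lemma sided_cross_flip1: "sided_cross h s r x x' y y' \<longleftrightarrow> sided_cross h (\<not> s) r x' x y y'"
  and sided_cross_flip2: "sided_cross h s r x x' y y' \<longleftrightarrow> sided_cross h s (\<not> r) x x' y' y"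
  and sided_cross_swap: "sided_cross h s r x x' y y' \<longleftrightarrow> sided_cross (\<not> h) r s y y' x x'"
  by (auto simp: sided_cross_def cross_def tri_def)

lemma under_inj: "x \<unrhd> y = x' \<unrhd> y \<longleftrightarrow> x = x'"
  using bij_under[of y] by (auto simp: bij_def dest: injD)

lemma over_inj: "x \<rhd> y = x' \<rhd> y \<longleftrightarrow> x = x'"
  using bij_over[of y] by (auto simp: bij_def dest: injD)

lemma under_surj: "\<exists>x. x \<unrhd> y = w"
  using bij_under[of y] unfolding bij_def surj_def by metis

lemma over_surj: "\<exists>x. x \<rhd> y = w"
  using bij_over[of y] unfolding bij_def surj_def by metis

lemma S_inj: "y \<rhd> x = y' \<rhd> x' \<Longrightarrow> x \<unrhd> y = x' \<unrhd> y' \<Longrightarrow> x = x' \<and> y = y'"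
  using bij_S injD[of "\<lambda>(x, y). (y \<rhd> x, x \<unrhd> y)" "(x, y)" "(x', y')"] by (auto simp: bij_def)

lemma S_surj: "\<exists>x y. y \<rhd> x = u \<and> x \<unrhd> y = v"
proof -
  have "(u, v) \<in> range (\<lambda>(x, y). (y \<rhd> x, x \<unrhd> y))"
    using bij_S by (simp add: bij_def)
  then show ?thesis by auto
qed

text \<open>According to the flags, this is the totality of the operations, the surjectivity of one of
  the right multiplications, or the surjectivity of \<open>S\<close>. As the flips move any pair of
  adjacent ends into the position of \<open>x\<close> and \<open>y\<close>, every such pair of colors
  extends to the crossing.\<close>

lemma sided_cross_exists: "\<exists>x' y'. sided_cross h s r x x' y y'"
  by (cases h; cases s; cases r;
      simp add: sided_cross_def cross_def tri_def; metis under_surj over_surj S_surj)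

lemma sided_cross_unique:
  assumes "sided_cross h s r x x' y y'" "sided_cross h s r x x'' y y''"
  shows "x' = x''" "y' = y''"
  using assms
  by (cases h; cases s; cases r;
      simp add: sided_cross_def cross_def tri_def; metis under_inj over_inj S_inj)+

text \<open>The three other pairs of adjacent ends reduce to the first one by renaming the two semiarcs
  of one or both strands.\<close>

lemma sided_cross_corner2:
  assumes "sided_cross h s r x x' y y'" "sided_cross h s r x x'' y'' y'"
  shows "x' = x''" "y = y''"
  using sided_cross_unique[of h s "\<not> r" x x' y' y x'' y''] assms sided_cross_flip2 by blast+

lemma sided_cross_corner3:
  assumes "sided_cross h s r x x' y y'" "sided_cross h s r x'' x' y y''"
  shows "x = x''" "y' = y''"
  using sided_cross_unique[of h "\<not> s" r x' x y y' x'' y''] assms sided_cross_flip1 by blast+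

lemma sided_cross_corner4:
  assumes "sided_cross h s r x x' y y'" "sided_cross h s r x'' x' y'' y'"
  shows "x = x''" "y = y''"
  using sided_cross_corner2[of h "\<not> s" r x' x y y' x'' y''] assms sided_cross_flip1 by blast+

text \<open>An exchange law with a repeated variable equates \<open>w \<unrhd> w\<close> and
  \<open>(x \<unrhd> x) \<unrhd> w\<close>; cancelling shows that \<open>(x, x)\<close> and \<open>(x, y)\<close>
  have the same image under \<open>S\<close>.\<close>

lemma S_diagonal:
  assumes "y \<rhd> x = w" "x \<unrhd> y = w"
  shows "x = y"
proof -
  have "w \<unrhd> w = (x \<unrhd> x) \<unrhd> w"
    using exchange1[of x y x] assms by simp
  then have x: "x \<unrhd> x = w" by (simp add: under_inj)
  show ?thesis
    using S_inj[of y x x x] x assms diagonal[of x] by simp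
qed

text \<open>In a kink the two strands of the crossing are joined by the loop \<open>k\<close>, which
  lies on the right of both or on the left of both. In the first case the outer colors are
  \<open>k \<unrhd> k\<close> and \<open>k \<rhd> k\<close>, which are equal; in the second one \<open>S\<close> maps them to a
  point of the diagonal.\<close>

lemma sided_cross_kink_loop: "sided_cross h s s k a k b \<Longrightarrow> a = b"
  unfolding sided_cross_def cross_def tri_def
  by (cases h; cases s; auto simp: diagonal intro: S_diagonal S_diagonal[symmetric])

lemma sided_cross_kink_loop_exists: "\<exists>k. sided_cross h s s k a k a"
proof (cases s)
  case True
  obtain x y where "y \<rhd> x = a" "x \<unrhd> y = a" using S_surj by blast
  then show ?thesis using S_diagonal[of y x a] True
    by (auto simp: sided_cross_def cross_def tri_def diagonal intro!: exI[of _ x])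
next
  case False
  then show ?thesis by (auto simp: sided_cross_def cross_def tri_def diagonal)
qed

lemma sided_cross_kink_loop_unique:
  assumes "sided_cross h s s k a k a" "sided_cross h s s k' a k' a"
  shows "k = k'"
  using assms S_inj[of k k k' k']
  by (cases h; cases s; simp add: sided_cross_def cross_def tri_def diagonal)

section \<open>Three strands\<close>

text \<open>Let \<open>x, y, z\<close> be the colors of the bottom, middle and top one of three strands
  on the right of the other two. The remaining colors are those a strand has when it has passed some of
  the others; the flags tell whether it is still on the right of the other two strands, in the order of
  height. Where a color has two descriptions, depending on which strand is passed first, one of them is
  chosen.\<close>

definition bottom :: "'x \<Rightarrow> 'x \<Rightarrow> 'x \<Rightarrow> bool \<Rightarrow> bool \<Rightarrow> 'x" where
  "bottom x y z m t =
     (if m then if t then x else x \<unrhd> z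
      else if t then x \<unrhd> y else (x \<unrhd> y) \<unrhd> (z \<rhd> y))"

definition middle :: "'x \<Rightarrow> 'x \<Rightarrow> 'x \<Rightarrow> bool \<Rightarrow> bool \<Rightarrow> 'x" where
  "middle x y z b t =
     (if b then if t then y else y \<unrhd> z
      else if t then y \<rhd> x else (y \<rhd> x) \<unrhd> (z \<rhd> x))"

definition top_strand :: "'x \<Rightarrow> 'x \<Rightarrow> 'x \<Rightarrow> bool \<Rightarrow> bool \<Rightarrow> 'x" where
  "top_strand x y z b m =
     (if b then if m then z else z \<rhd> y
      else if m then z \<rhd> x else (z \<rhd> x) \<rhd> (y \<rhd> x))"

lemmas cube_defs = bottom_def middle_def top_strand_def

text \<open>The three faces around the edges \<open>x, y, z\<close> hold by definition. At the opposite
  corner every color has two descriptions, which agree by the exchange laws.\<close>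

lemma cube_faces:
  "sided_cross True m b (bottom x y z m t) (bottom x y z (\<not> m) t) (middle x y z b t) (middle x y z (\<not> b) t)"
  "sided_cross True t b (bottom x y z m t) (bottom x y z m (\<not> t)) (top_strand x y z b m) (top_strand x y z (\<not> b) m)"
  "sided_cross True t m (middle x y z b t) (middle x y z b (\<not> t)) (top_strand x y z b m) (top_strand x y z b (\<not> m))"
  using exchange1[of x z y] exchange2[of y x z] exchange3[of z x y]
  by (cases b; cases m; cases t; simp add: sided_cross_def cross_def tri_def cube_defs exchange1 exchange2 exchange3)+

text \<open>The three prescribed edges meet in a corner of the cube. Starting from this corner, one
  walks to the corner where all three strands are on the right of each other, inverting a multiplication
  or \<open>S\<close> on the way.\<close>

lemma cube_fill: "\<exists>x y z. bottom x y z m t = p \<and> middle x y z b t = q \<and> top_strand x y z b m = r"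
proof (cases "m \<or> b \<or> t")
  case True
  then show ?thesis
    by (cases b; cases m; cases t; simp add: cube_defs; metis under_surj over_surj S_surj)
next
  case False
  \<comment> \<open>This is the corner opposite to \<open>x, y, z\<close>. Undoing two of its faces determines \<open>x, y, z\<close>; the third
    exchange law shows that the top color \<open>z \<rhd> y\<close> obtained from them is the given \<open>r2\<close>.\<close>
  obtain q1 r1 where qr: "q1 \<unrhd> r1 = q" "r1 \<rhd> q1 = r" using S_surj by blast
  obtain p1 r2 where pr: "p1 \<unrhd> r2 = p" "r2 \<rhd> p1 = r" using S_surj by blast
  obtain x y where xy: "x \<unrhd> y = p1" "y \<rhd> x = q1" using S_surj by blast
  obtain z where z: "z \<rhd> x = r1" using over_surj by blast
  have "(z \<rhd> y) \<rhd> p1 = r2 \<rhd> p1"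
    using exchange3[of z y x] qr pr xy z exchange3[of z x y] by simp
  then have "z \<rhd> y = r2" by (simp add: over_inj)
  then show ?thesis
    using False qr pr xy z by (intro exI[of _ x] exI[of _ y] exI[of _ z]) (simp add: cube_defs)
qed

text \<open>The assumptions are the three faces around a corner with edges \<open>x, y, z\<close>, the
  conclusion consists of the three faces around the opposite corner. There is a whole cube with the
  edges \<open>x, y, z\<close>, and \<open>sided_cross_unique\<close> shows that it has the given faces.\<close>

lemma sided_cross_cube_top:
  assumes "sided_cross True m b x x1 y y1" "sided_cross True t b x x2 z z1"
    "sided_cross True t m y y2 z z2"
  shows "\<exists>x' y' z'. sided_cross True m b x2 x' y2 y' \<and> sided_cross True t b x1 x' z2 z' \<and>
    sided_cross True t m y1 y' z1 z'"
proof -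
  obtain u v w where uvw: "bottom u v w m t = x" "middle u v w b t = y" "top_strand u v w b m = z"
    using cube_fill by blast
  note faces = cube_faces[where x = u and y = v and z = w]
  have x1: "bottom u v w (\<not> m) t = x1" and y1: "middle u v w (\<not> b) t = y1"
    using sided_cross_unique assms(1) faces(1)[of m b t] uvw by metis+
  have x2: "bottom u v w m (\<not> t) = x2" and z1: "top_strand u v w (\<not> b) m = z1"
    using sided_cross_unique assms(2) faces(2)[of t b m] uvw by metis+
  have y2: "middle u v w b (\<not> t) = y2" and z2: "top_strand u v w b (\<not> m) = z2"
    using sided_cross_unique assms(3) faces(3)[of t m b] uvw by metis+
  show ?thesis
    using faces(1)[of m b "\<not> t"] faces(2)[of t b "\<not> m"] faces(3)[of t m "\<not> b"]
    unfolding x1 y1 x2 z1 y2 z2 by blast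
qed

text \<open>The three strands keep their names here, whatever their heights: \<open>h\<close> orders the
  first two, and the third one lies above both iff \<open>h'\<close>. Each of the four cases is the
  previous lemma for the strands sorted by height.\<close>

lemma sided_cross_cube:
  assumes ab: "sided_cross h m b x x1 y y1" and ac: "sided_cross h' t b x x2 z z1"
    and bc: "sided_cross h' t m y y2 z z2"
  shows "\<exists>x' y' z'. sided_cross h m b x2 x' y2 y' \<and> sided_cross h' t b x1 x' z2 z' \<and>
    sided_cross h' t m y1 y' z1 z'"
proof (cases h; cases h')
  assume h: h h'
  show ?thesis using sided_cross_cube_top[of m b x x1 y y1 t x2 z z1 y2 z2] assms h by simp
next
  assume h: h "\<not> h'"
  show ?thesis
    using sided_cross_cube_top[of b t z z1 x x2 m z2 y y2 x1 y1] assms h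
    by (simp add: sided_cross_swap[of False]) blast
next
  assume h: "\<not> h" h'
  show ?thesis
    using sided_cross_cube_top[of b m y y1 x x1 t y2 z z2 x2 z1] assms h
    by (simp add: sided_cross_swap[of False]) blast
next
  assume h: "\<not> h" "\<not> h'"
  show ?thesis
    using sided_cross_cube_top[of m t z z2 y y2 b z1 x x2 y1 x1] assms h
    by (simp add: sided_cross_swap[of False]) blast
qed

end

section \<open>Partial products and crossings\<close>

context partially_multiplicative_biquandle
begin

definition is_product :: "'x \<Rightarrow> 'x \<Rightarrow> 'x \<Rightarrow> bool" where
  "is_product a b c \<longleftrightarrow> (a, b) \<in> D \<and> c = a \<odot> b"

lemma product_unique: "is_product a b c \<Longrightarrow> is_product a b c' \<Longrightarrow> c = c'"
  and product_cancel_left: "is_product a b c \<Longrightarrow> is_product a b' c \<Longrightarrow> b = b'"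
  and product_cancel_right: "is_product a b c \<Longrightarrow> is_product a' b c \<Longrightarrow> a = a'"
  using inj_left[of a] inj_right[of b] by (auto simp: is_product_def inj_on_def)

lemma product_assoc: "(\<exists>k. is_product a b k \<and> is_product k c d) \<longleftrightarrow> (\<exists>k. is_product b c k \<and> is_product a k d)"
  using assoc_dom[of a b c] assoc[of a b c] by (auto simp: is_product_def)

lemma product_interchange: "(\<exists>k. is_product a b k \<and> is_product c d k) \<longleftrightarrow> (\<exists>k. is_product a k c \<and> is_product k d b)"
  using interchange[of a b c d] by (auto simp: is_product_def)

lemma tri_product: "is_product a b c \<Longrightarrow> tri h x c = tri h (tri h x a) b"
  by (auto simp: is_product_def tri_def under_mult over_mult)

lemma product_tri:
  assumes "is_product a b c"
  shows "is_product (tri h a x) (tri h b (tri (\<not> h) x a)) (tri h c x)"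
  using assms act_dom_under[of a b x] act_dom_over[of a b x]
  by (auto simp: is_product_def tri_def mult_under mult_over)

lemma tri_composable: "(a, b) \<in> D \<longleftrightarrow> (tri h a x, tri h b (tri (\<not> h) x a)) \<in> D"
  using act_dom_under[of a b x] act_dom_over[of a b x] by (auto simp: tri_def)

lemma product_commute:
  assumes "cross h x y x' y'"
  shows "is_product x y' c \<longleftrightarrow> is_product y x' c"
  using assms twist_dom[of x y] twist[of x y] twist_dom[of y x] twist[of y x]
  by (auto simp: is_product_def cross_def tri_def)

lemma tri_diagonal: "tri h x x = tri h' x x"
  by (simp add: tri_def diagonal)

lemma tri_surj: "\<exists>x. tri h x y = w"
  by (cases h; simp add: tri_def under_surj over_surj)

lemma tri_diagonal_surj: "\<exists>x. tri h x x = w"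
  using S_surj[of w w] S_diagonal diagonal by (metis tri_def)

lemma cross_target_unique: "cross h x y x' y' \<Longrightarrow> cross h u v x' y' \<Longrightarrow> x = u \<and> y = v"
  using sided_cross_unique[of h False False x' x y' y u v]
  by (simp add: sided_cross_def)

text \<open>The axiom behind \<open>product_commute\<close> describes two like edges at a vertex that
  cross each other; here one of the crossing edges carries the product. Let \<open>y = x \<odot>
  c\<close> and let \<open>w\<close> be the common value of the two operations at \<open>(x, x)\<close>.
  Then \<open>x'\<close> is \<open>w\<close> acted on by \<open>c\<close>, as a product acts like its
  factors in turn, and \<open>y'\<close> is the product of \<open>w\<close> with \<open>c\<close> acted
  on by \<open>w\<close>. By \<open>product_commute\<close> this is \<open>c \<odot> x'\<close>. The
  converse retraces this from \<open>x'\<close> and \<open>c\<close>, as \<open>w\<close> and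
  \<open>x\<close> can be recovered by surjectivity.\<close>

lemma product_twist:
  assumes "cross h x y x' y'"
  shows "is_product x c y \<longleftrightarrow> is_product c x' y'"
proof -
  have forward: "is_product c (tri h x z) (tri (\<not> h) z x)" if "is_product x c z" for x z
  proof -
    define w where "w = tri h x x"
    have w: "w = tri (\<not> h) x x" unfolding w_def by (rule tri_diagonal)
    have "is_product w (tri (\<not> h) c w) (tri (\<not> h) z x)"
      using product_tri[OF that, of "\<not> h" x] by (simp add: w_def flip: w)
    moreover have "cross h w c (tri h w c) (tri (\<not> h) c w)"
      by (simp add: cross_def)
    moreover have "tri h x z = tri h w c"
      unfolding w_def using that by (rule tri_product)
    ultimately show ?thesis using product_commute by metis
  qed
  have x': "x' = tri h x y" and y': "y' = tri (\<not> h) y x"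
    using assms by (auto simp: cross_def)
  show ?thesis
  proof
    assume "is_product x c y"
    then show "is_product c x' y'" unfolding x' y' by (rule forward)
  next
    assume p: "is_product c x' y'"
    obtain w where w: "tri h w c = x'" using tri_surj by blast
    obtain u where u: "tri h u u = w" using tri_diagonal_surj by blast
    have u': "tri (\<not> h) u u = w" using u tri_diagonal by metis
    have "cross h w c x' (tri (\<not> h) c w)" using w by (simp add: cross_def)
    then have "is_product w (tri (\<not> h) c w) y'" using p product_commute by blast
    then have "(u, c) \<in> D"
      using tri_composable[of u c "\<not> h" u] by (simp add: is_product_def u u')
    then have up: "is_product u c (u \<odot> c)" by (simp add: is_product_def)
    have "is_product c (tri h u (u \<odot> c)) (tri (\<not> h) (u \<odot> c) u)"
      using forward[OF up] .
    moreover have "tri h u (u \<odot> c) = x'" using tri_product[OF up, of h u] u w by simp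
    ultimately have "cross h u (u \<odot> c) x' y'"
      using p product_unique by (metis cross_def)
    then show "is_product x c y" using cross_target_unique assms up by blast
  qed
qed

lemma product_twist':
  assumes "cross h x y x' y'"
  shows "is_product y c x \<longleftrightarrow> is_product c y' x'"
  using product_twist[of "\<not> h" y x y' x'] assms cross_swap by blast

text \<open>A strand with color \<open>t\<close> first passes \<open>a\<close> and then
  \<open>b\<close>, with color \<open>t1\<close> in between; it has the same effect as passing the
  product \<open>c\<close>. If \<open>s\<close> is false, the primed colors are the ones on the right,
  and the statement uses that composability is reflected, not only preserved, by the action.\<close>

lemma pass_two_factors:
  assumes "is_product a b c" "sided_cross h s True a a' t t1" "sided_cross h s True b b' t1 t2"
  shows "\<exists>c'. is_product a' b' c' \<and> sided_cross h s True c c' t t2"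
proof (cases s)
  case True
  then have eqs: "a' = tri h a t" "t1 = tri (\<not> h) t a" "b' = tri h b t1" "t2 = tri (\<not> h) t1 b"
    using assms(2,3) by (auto simp: sided_cross_def cross_def)
  then have "is_product a' b' (tri h c t)" "t2 = tri (\<not> h) t c"
    using product_tri[OF assms(1), of h t] tri_product[OF assms(1), of "\<not> h" t] by simp_all
  then show ?thesis using True by (auto simp: sided_cross_def cross_def)
next
  case False
  then have eqs: "a = tri h a' t" "t1 = tri (\<not> h) t a'" "b = tri h b' t1" "t2 = tri (\<not> h) t1 b'"
    using assms(2,3) by (auto simp: sided_cross_def cross_def)
  then have "(a', b') \<in> D"
    using assms(1) tri_composable[of a' b' h t] by (simp add: is_product_def)
  then have p: "is_product a' b' (a' \<odot> b')" by (simp add: is_product_def)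
  then have "is_product a b (tri h (a' \<odot> b') t)" "t2 = tri (\<not> h) t (a' \<odot> b')"
    using product_tri[OF p, of h t] tri_product[OF p, of "\<not> h" t] eqs by simp_all
  then show ?thesis using p False product_unique[OF assms(1)]
    by (auto simp: sided_cross_def cross_def)
qed

text \<open>In the remaining forms the strand is known to pass another selection of the three edges. One
  completes the crossings with \<open>a\<close> and \<open>b\<close> in some way and compares the result
  of \<open>pass_two_factors\<close> with the given crossings by uniqueness.\<close>

lemma pass_product:
  assumes "is_product a b c" "sided_cross h s True c c' t t2"
  shows "\<exists>a' b' t1. is_product a' b' c' \<and> sided_cross h s True a a' t t1 \<and> sided_cross h s True b b' t1 t2"
proof -
  obtain a' t1 where a: "sided_cross h s True a a' t t1" using sided_cross_exists by blast
  obtain b' t3 where b: "sided_cross h s True b b' t1 t3" using sided_cross_exists by blast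
  show ?thesis
    using pass_two_factors[OF assms(1) a b] a b sided_cross_unique[OF assms(2)] by metis
qed

lemma pass_left_factor:
  assumes "is_product a b c" "sided_cross h s True a a' t t1"
  shows "\<exists>b' c' t2. is_product a' b' c' \<and> sided_cross h s True b b' t1 t2 \<and> sided_cross h s True c c' t t2"
  using pass_two_factors[OF assms] sided_cross_exists by metis

lemma pass_right_factor:
  assumes "is_product a b c" "sided_cross h s True b b' t1 t2"
  shows "\<exists>a' c' t. is_product a' b' c' \<and> sided_cross h s True a a' t t1 \<and> sided_cross h s True c c' t t2"
proof -
  obtain a' t where "sided_cross h s False a a' t1 t" using sided_cross_exists by blast
  then have "sided_cross h s True a a' t t1" by (simp add: sided_cross_flip2[of h s True])
  then show ?thesis using pass_two_factors assms by blast
qed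

lemma pass_left_factor_product:
  assumes "is_product a b c" "sided_cross h s True a a' t t1" "sided_cross h s True c c' t t2"
  shows "\<exists>b'. is_product a' b' c' \<and> sided_cross h s True b b' t1 t2"
  using pass_left_factor[OF assms(1,2)] sided_cross_unique[OF assms(3)] by metis

lemma pass_right_factor_product:
  assumes "is_product a b c" "sided_cross h s True b b' t1 t2" "sided_cross h s True c c' t t2"
  shows "\<exists>a'. is_product a' b' c' \<and> sided_cross h s True a a' t t1"
proof -
  obtain a' c'' t' where p: "is_product a' b' c''" "sided_cross h s True a a' t' t1"
      "sided_cross h s True c c'' t' t2"
    using pass_right_factor[OF assms(1,2)] by blast
  have "c'' = c'" "t' = t"
    using sided_cross_unique[of h s False c c'' t2 t' c' t] p(3) assms(3)
    by (simp_all add: sided_cross_flip2[of h s True])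
  then show ?thesis using p by blast
qed

section \<open>Inverses\<close>

text \<open>The interchange axiom for the trivial equation \<open>a \<odot> b = a \<odot> b\<close>: its
  element \<open>e\<close> is a right identity of \<open>a\<close> and a left identity of
  \<open>b\<close>.\<close>

lemma product_identities:
  assumes "is_product a b c"
  obtains e where "is_product a e a" "is_product e b b"
  using product_interchange[of a b a b] assms by blast

text \<open>By the twist axiom \<open>x \<odot> k\<close> is also a product \<open>l \<odot> _\<close>
  with \<open>l \<unrhd> x = k\<close>, and being a left factor is invariant under the action of
  \<open>x\<close>.\<close>

lemma product_left_factor:
  assumes "is_product x k w"
  shows "\<exists>y z. is_product k y z"
proof -
  obtain l where l: "tri True l x = k" using tri_surj by blast
  then have "cross True l x k (tri False x l)" by (simp add: cross_def)
  then have "(l, tri False x l) \<in> D"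
    using assms product_commute unfolding is_product_def by blast
  then have "(tri True l x, tri True (tri False x l) (tri False x l)) \<in> D"
    using tri_composable[of l "tri False x l" True x] by simp
  then show ?thesis unfolding l by (auto simp: is_product_def)
qed

text \<open>A similar argument, in which the action of a suitable \<open>a\<close> moves
  \<open>k\<close> to the right factor supplied by the twist axiom and \<open>a\<close> to its left
  factor \<open>l\<close>.\<close>

lemma product_right_factor:
  assumes "is_product k y z"
  shows "\<exists>x w. is_product x k w"
proof -
  obtain l where l: "tri True l k = y" using tri_surj by blast
  then have "cross True l k y (tri False k l)" by (simp add: cross_def)
  then have *: "(l, tri False k l) \<in> D"
    using assms product_commute unfolding is_product_def by blast
  obtain a where a: "tri False a a = l" using tri_diagonal_surj by blast
  then have "tri True a a = l" by (metis tri_diagonal)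
  then have "(a, k) \<in> D"
    using tri_composable[of a k False a] a * by simp
  then show ?thesis by (auto simp: is_product_def)
qed

text \<open>If \<open>w = x \<odot> k\<close> and \<open>e\<close> is a right identity of
  \<open>k\<close>, then \<open>w \<odot> e = x \<odot> k\<close>, and the interchange axiom applied to
  this equation yields \<open>k'\<close> with \<open>w \<odot> k' = x\<close> and \<open>k' \<odot> k =
  e\<close>. By the second equation it does not depend on \<open>x\<close>.\<close>

lemma half_inverse:
  assumes "is_product x k w"
  shows "\<exists>k'. (\<forall>x w. is_product x k w \<longrightarrow> is_product w k' x) \<and>
    (\<forall>y z. is_product k y z \<longrightarrow> is_product k' z y)"
proof -
  obtain e where e: "is_product k e k"
    using product_left_factor[OF assms] product_identities by blast
  have inv: "\<exists>k'. is_product w k' x \<and> is_product k' k e" if "is_product x k w" for x w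
  proof -
    have "is_product w e w"
      using product_assoc[of x k e w] product_unique e that by blast
    then show ?thesis using product_interchange[of w e x k] that by blast
  qed
  then obtain k' where k': "is_product k' k e" using assms by blast
  then have "is_product w k' x" if "is_product x k w" for x w
    using inv[OF that] product_cancel_right by blast
  moreover have "is_product k' z y" if "is_product k y z" for y z
  proof -
    have "is_product e y y"
      using product_identities[OF that] e product_cancel_left by metis
    then show ?thesis
      using product_assoc[of k' k y y] k' that product_unique by blast
  qed
  ultimately show ?thesis by blast
qed

text \<open>Inverting twice gives \<open>k\<close> back, so the implications of the previous lemma are
  equivalences.\<close>

lemma inverse_exists:
  assumes "is_product x k w"
  obtains k' where "\<And>x w. is_product x k w \<longleftrightarrow> is_product w k' x"
    "\<And>y z. is_product k y z \<longleftrightarrow> is_product k' z y"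
proof -
  obtain k' where k': "\<And>x w. is_product x k w \<Longrightarrow> is_product w k' x"
      "\<And>y z. is_product k y z \<Longrightarrow> is_product k' z y"
    using half_inverse[OF assms] by blast
  obtain k'' where k'': "\<And>x w. is_product x k' w \<Longrightarrow> is_product w k'' x"
      "\<And>y z. is_product k' y z \<Longrightarrow> is_product k'' z y"
    using half_inverse[OF k'(1)[OF assms]] by blast
  have "k'' = k"
    using assms k'(1) k''(1) product_cancel_left by blast
  then show ?thesis using that k' k'' by blast
qed

lemma common_right_factor_inverse: "is_product x k w \<Longrightarrow> is_product y k z \<Longrightarrow>
    \<exists>k'. is_product w k' x \<and> is_product z k' y"
  using inverse_exists by metis

lemma common_left_factor_inverse: "is_product k x w \<Longrightarrow> is_product k y z \<Longrightarrow>
    \<exists>k'. is_product k' w x \<and> is_product k' z y"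
  using inverse_exists product_right_factor by metis

text \<open>The element \<open>l\<close> is the product of the inverse of \<open>y\<close> with
  \<open>z\<close>. The hypotheses say that \<open>w\<close> is \<open>x\<close> times the inverse of
  \<open>y\<close> times \<open>z\<close>, and associativity brackets this product the other way.\<close>

lemma common_left_quotient:
  assumes "is_product k z w" "is_product k y x"
  shows "\<exists>l. is_product x l w \<and> is_product y l z"
proof -
  obtain y' where y': "\<And>x w. is_product x y w \<longleftrightarrow> is_product w y' x"
    "\<And>w z. is_product y w z \<longleftrightarrow> is_product y' z w"
    using inverse_exists[OF assms(2)] by metis
  then show ?thesis using assms product_assoc[of x y' z w] by blast
qed

lemma common_right_quotient:
  assumes "is_product x k w" "is_product y k z"
  shows "\<exists>l. is_product l z w \<and> is_product l y x"
proof -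
  obtain a where "is_product a y (a \<odot> y)"
    using product_right_factor[OF assms(2)] by (auto simp: is_product_def)
  then obtain y' where y': "\<And>x w. is_product x y w \<longleftrightarrow> is_product w y' x"
    "\<And>w z. is_product y w z \<longleftrightarrow> is_product y' z w"
    by (metis inverse_exists)
  then show ?thesis using assms product_assoc[of x y' z w] by blast
qed

section \<open>Colors at a vertex\<close>

text \<open>The condition at a vertex for its edges in counterclockwise order, a flag being true if the
  edge is incoming.\<close>

fun vertex_colors :: "bool \<Rightarrow> bool \<Rightarrow> bool \<Rightarrow> 'x \<Rightarrow> 'x \<Rightarrow> 'x \<Rightarrow> bool" where
  "vertex_colors d1 d2 d3 a b c \<longleftrightarrow>
     (if d1 = d2 then if d1 then is_product b a c else is_product a b c
      else if d2 = d3 then if d2 then is_product c b a else is_product b c a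
      else if d3 then is_product a c b else is_product c a b)"

lemma vertex_colors_rotate:
  "no_source_sink d1 d2 d3 \<Longrightarrow> vertex_colors d1 d2 d3 a b c \<longleftrightarrow> vertex_colors d2 d3 d1 b c a"
  by (auto simp: no_source_sink_def)

lemma vertex_colors_unique:
  assumes "vertex_colors d1 d2 d3 a b c" "vertex_colors d1 d2 d3 a b c'"
  shows "c = c'"
  using assms by (auto split: if_splits dest: product_unique product_cancel_left product_cancel_right)

text \<open>If the directions of the four outer edges alternate, the inner color of either side is a
  quotient of two outer colors in two ways, and the inverse of the inner color accounts for the two
  directions that the inner edge may have. Otherwise the statement is associativity if three outer edges
  have the same direction, and the interchange axiom if exactly two neighbors do.\<close>

lemma IH_colors:
  assumes "no_source_sink dw dx (\<not> up)" "no_source_sink up dy dz"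
    "no_source_sink dw (\<not> right) dz" "no_source_sink right dx dy"
    and "vertex_colors dw dx (\<not> up) w x k" "vertex_colors up dy dz k y z"
  shows "\<exists>k'. vertex_colors dw (\<not> right) dz w k' z \<and> vertex_colors right dx dy k' x y"
proof (cases "dw \<noteq> dx \<and> dx \<noteq> dy \<and> dy \<noteq> dz")
  case True
  then show ?thesis
    using assms
    by (cases dw; cases dx; cases dy; cases dz; cases up; cases right;
      simp add: no_source_sink_def;
      metis common_left_quotient common_right_quotient common_left_factor_inverse
        common_right_factor_inverse)
next
  case False
  then show ?thesis
    using assms product_assoc product_interchange
    by (cases dw; cases dx; cases dy; cases dz; cases up; cases right;
      simp add: no_source_sink_def; blast)
qed

lemma twist_colors:
  assumes "no_source_sink da db dc" "sided_cross h db da a2 a b b2"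
  shows "vertex_colors db da dc b2 a2 c \<longleftrightarrow> vertex_colors da db dc a b c"
  using assms unfolding no_source_sink_def sided_cross_def
  by (cases da; cases db; cases dc; simp add: product_commute product_twist product_twist')

text \<open>Which of the forms of passing applies depends on the edge that carries the product: it is
  \<open>c1\<close> if \<open>a2\<close> and \<open>b2\<close> have the same direction, and otherwise
  the one of them whose direction differs from the other two.\<close>

lemma pass_colors_two:
  assumes "no_source_sink da db dc" "vertex_colors da db dc a2 b2 c1"
   "sided_cross h s da a2 a1 t2 t1" "sided_cross h s db b2 b1 t3 t2"
  shows "\<exists>c2. vertex_colors da db dc a1 b1 c2 \<and> sided_cross h s (\<not> dc) c1 c2 t3 t1"
  using assms pass_two_factors pass_left_factor_product pass_right_factor_product
  unfolding no_source_sink_def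
  by (cases da; cases db; cases dc; simp add: sided_cross_flip2[of h s False]; blast)

lemma pass_colors_one:
  assumes "no_source_sink da db dc" "vertex_colors da db dc a1 b1 c2"
   "sided_cross h s (\<not> dc) c2 c1 t3 t1"
  shows "\<exists>a2 b2 t2. vertex_colors da db dc a2 b2 c1 \<and>
   sided_cross h s da a1 a2 t2 t1 \<and> sided_cross h s db b1 b2 t3 t2"
proof -
  consider "da" "db" "\<not> dc" | "da" "\<not> db" "dc" | "da" "\<not> db" "\<not> dc"
    | "\<not> da" "db" "dc" | "\<not> da" "db" "\<not> dc" | "\<not> da" "\<not> db" "dc"
    using assms(1) unfolding no_source_sink_def by blast
  then show ?thesis
  proof cases
    case 1
    then show ?thesis using pass_product[of b1 a1 c2 h s c1 t3 t1] assms by (simp; blast)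
  next
    case 2
    then show ?thesis using pass_right_factor[of a1 c2 b1 h s c1 t1 t3] assms
      by (simp add: sided_cross_flip2[of h s False]; blast)
  next
    case 3
    then show ?thesis using pass_right_factor[of b1 c2 a1 h s c1 t3 t1] assms
      by (simp add: sided_cross_flip2[of h s False]; blast)
  next
    case 4
    then show ?thesis using pass_left_factor[of c2 b1 a1 h s c1 t1 t3] assms
      by (simp add: sided_cross_flip2[of h s False]; blast)
  next
    case 5
    then show ?thesis using pass_left_factor[of c2 a1 b1 h s c1 t3 t1] assms
      by (simp add: sided_cross_flip2[of h s False]; blast)
  next
    case 6
    then show ?thesis using pass_product[of a1 b1 c2 h s c1 t1 t3] assms
      by (simp add: sided_cross_flip2[of h s False]; blast)
  qed
qed

end

section \<open>Labels at the boundary of a move\<close>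

lemma ends_map_node: "ends (map_node f n) = map (apfst f) (ends n)"
  by (cases n) auto

lemma node_coloring_map:
  "node_coloring u v D m c (map_node f n) \<longleftrightarrow> node_coloring u v D m (c \<circ> f) n"
  by (cases n) auto

lemma node_coloring_cong:
  "(\<And>e. e \<in> set_node n \<Longrightarrow> c e = c' e) \<Longrightarrow> node_coloring u v D m c n \<longleftrightarrow> node_coloring u v D m c' n"
  by (cases n) (auto split: if_splits)

lemma set_node_ends: "set_node n = fst ` set (ends n)"
  by (cases n) auto

text \<open>What the definition of a diagram says about ends, for a set of nodes that need not be closed
  up.\<close>

definition end_disjoint :: "'e node set \<Rightarrow> bool" where
  "end_disjoint M \<longleftrightarrow> (\<forall>n\<in>M. distinct (ends n)) \<and>
     (\<forall>n\<in>M. \<forall>n'\<in>M. n \<noteq> n' \<longrightarrow> set (ends n) \<inter> set (ends n') = {})"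

lemma ends_crossing:
  "set (ends (crossing h e1 e2 e3 e4 p q)) = {(e1, p), (e2, q), (e3, \<not> p), (e4, \<not> q)}"
  "distinct (ends (crossing h e1 e2 e3 e4 p q)) \<longleftrightarrow>
     distinct [(e1, p), (e2, q), (e3, \<not> p), (e4, \<not> q)]"
  by (cases h; cases p; cases q; auto)+

lemma ends_vertex:
  "no_source_sink d1 d2 d3 \<Longrightarrow> set (ends (vertex (e1, d1) (e2, d2) (e3, d3))) = {(e1, d1), (e2, d2), (e3, d3)}"
  "no_source_sink d1 d2 d3 \<Longrightarrow> distinct (ends (vertex (e1, d1) (e2, d2) (e3, d3))) \<longleftrightarrow>
     distinct [(e1, d1), (e2, d2), (e3, d3)]"
  by (auto simp: no_source_sink_def)

lemma set_node_crossing: "set_node (crossing h e1 e2 e3 e4 p q) = {e1, e2, e3, e4}"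
  unfolding set_node_ends ends_crossing by auto

lemma set_node_vertex: "set_node (vertex (e1, d1) (e2, d2) (e3, d3)) = {e1, e2, e3}"
  by auto

lemma crossing_neq_vertex: "crossing h e1 e2 e3 e4 p q \<noteq> vertex v1 v2 v3"
  by (cases v1; cases v2; cases v3; auto)

lemma end_disjoint_map:
  assumes "end_disjoint (map_node f ` M)" "inj_on f A" "\<And>n. n \<in> M \<Longrightarrow> set_node n \<subseteq> A"
  shows "end_disjoint M"
proof -
  have "n = n'" if n: "n \<in> M" "n' \<in> M" and e: "x \<in> set (ends n)" "x \<in> set (ends n')" for n n' x
  proof -
    have "apfst f x \<in> set (ends (map_node f n)) \<inter> set (ends (map_node f n'))"
      using e by (simp add: ends_map_node)
    then have eq: "map_node f n = map_node f n'"
      using assms(1) n unfolding end_disjoint_def by blast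
    show ?thesis
      using node.inj_map_strong[OF _ eq] assms(2,3) n by (meson inj_on_contraD subsetD)
  qed
  moreover have "distinct (ends n)" if "n \<in> M" for n
    using that assms(1) unfolding end_disjoint_def by (auto simp: ends_map_node distinct_map)
  ultimately show ?thesis unfolding end_disjoint_def by blast
qed

text \<open>The ends met at the three crossings of either side of the third Reidemeister move, in
  abstract form: \<open>A, A', B, B', T, T'\<close> are the two ends of the inner semiarcs of the
  strands \<open>a, b, t\<close>. If the three sets of a side are disjoint, the twelve ends on this side
  are different, which implies the claim. If two sets of the first side coincide, two inner ends have to be
  outer ends as well. Then some node of the second side has a repeated end, or all nodes of the second
  side coincide, and a single node would contain all six inner ends.\<close>

lemma triangle_sides_disjoint:
  fixes a b t a' b' t' A A' B B' T T' :: 'd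
  assumes inner: "distinct [A, A', B, B', T, T']"
    and side1: "pairwise disjnt {{a, T', A', t}, {b, t', B', T}, {A, B, a', b'}}"
    and distinct1: "distinct [a, T', A', t]" "distinct [b, t', B', T]" "distinct [A, B, a', b']"
    and side2: "pairwise disjnt {{a, b, A', B'}, {B, T', b', t}, {A, t', a', T}}"
    and distinct2: "distinct [a, b, A', B']" "distinct [B, T', b', t]" "distinct [A, t', a', T]"
  shows "{a, b, t, a', b', t'} \<inter> {A, A', B, B', T, T'} = {}"
proof -
  define AB BT AT where "AB = {a, b, A', B'}" and "BT = {B, T', b', t}" and "AT = {A, t', a', T}"
  note defs = AB_def BT_def AT_def
  define P Q R where "P = {a, T', A', t}" and "Q = {b, t', B', T}" and "R = {A, B, a', b'}"
  note defs1 = P_def Q_def R_def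
  have "pairwise disjnt {P, Q, R}" using side1 by (simp only: defs1)
  then have disjoint: "X \<noteq> Y \<Longrightarrow> disjnt X Y" if "X \<in> {P, Q, R}" "Y \<in> {P, Q, R}" for X Y
    using that unfolding pairwise_def by blast
  have meet: "X = Y" if "x \<in> X" "x \<in> Y" "X \<in> {AB, BT, AT}" "Y \<in> {AB, BT, AT}" for x X Y
  proof -
    have "pairwise disjnt {AB, BT, AT}" using side2 by (simp only: defs)
    then show ?thesis using that unfolding pairwise_def disjnt_def by (metis disjoint_iff)
  qed
  have not_all_equal: False if "AB = BT" "AB = AT"
  proof -
    have "T \<in> AT" "T' \<in> BT" "A \<in> AT" by (simp_all add: defs)
    then have "T \<in> AB" "T' \<in> AB" "A \<in> AB" using that by blast+
    then show False using inner by (auto simp: AB_def)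
  qed
  have "P \<noteq> Q"
  proof
    assume "P = Q"
    then have "T \<in> P" "B' \<in> P" by (simp_all add: defs1)
    then have "a = B' \<or> a = T \<and> t = B'" using inner by (auto simp: defs1)
    then consider "a = B'" | "a = T" "t = B'" by blast
    then show False
    proof cases
      case 1
      then show False using distinct2 by simp
    next
      case 2
      have "AB = AT" by (rule meet[of T]) (simp_all add: defs 2)
      moreover have "AB = BT" by (rule meet[of B']) (simp_all add: defs 2)
      ultimately show False using not_all_equal by blast
    qed
  qed
  then have 12: "disjnt P Q"
    using disjoint by simp
  have "P \<noteq> R"
  proof
    assume "P = R"
    then have "A \<in> P" "B \<in> P" by (simp_all add: defs1)
    then have "t = B \<or> a = B \<and> t = A" using inner by (auto simp: defs1)
    then consider "t = B" | "a = B" "t = A" by blast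
    then show False
    proof cases
      case 1
      then show False using distinct2 by simp
    next
      case 2
      have "AB = BT" by (rule meet[of B]) (simp_all add: defs 2)
      moreover have "BT = AT" by (rule meet[of A]) (simp_all add: defs 2)
      ultimately show False using not_all_equal by blast
    qed
  qed
  then have 13: "disjnt P R"
    using disjoint by simp
  have "Q \<noteq> R"
  proof
    assume "Q = R"
    then have "A \<in> Q" "B \<in> Q" by (simp_all add: defs1)
    then have "t' = A \<or> b = A \<and> t' = B" using inner by (auto simp: defs1)
    then consider "t' = A" | "b = A" "t' = B" by blast
    then show False
    proof cases
      case 1
      then show False using distinct2 by simp
    next
      case 2
      have "AB = AT" by (rule meet[of A]) (simp_all add: defs 2)
      moreover have "AT = BT" by (rule meet[of B]) (simp_all add: defs 2)
      ultimately show False using not_all_equal by blast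
    qed
  qed
  then have 23: "disjnt Q R"
    using disjoint by simp
  show ?thesis
    using 12 13 23 distinct1 by (simp add: defs1 eq_commute)
qed

lemma end_disjoint_pairwise:
  "end_disjoint M \<Longrightarrow> pairwise disjnt ((\<lambda>n. set (ends n)) ` M)"
  unfolding end_disjoint_def pairwise_image by (simp add: pairwise_def disjnt_def)

text \<open>The two ends of a semiarc account for its label with either flag. This converts between ends
  and labels.\<close>

lemma both_flags: "{(e, d), (e, \<not> d)} = {e} \<times> UNIV"
  by (cases d) (auto simp: UNIV_bool)

lemma both_flags3:
  "{(a, d1), (a, \<not> d1), (b, d2), (b, \<not> d2), (t, d3), (t, \<not> d3)} = {a, b, t} \<times> UNIV"
proof -
  have "{(a, d1), (a, \<not> d1), (b, d2), (b, \<not> d2), (t, d3), (t, \<not> d3)} =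
   {(a, d1), (a, \<not> d1)} \<union> {(b, d2), (b, \<not> d2)} \<union> {(t, d3), (t, \<not> d3)}" by (simp add: insert_commute)
  also have "\<dots> = {a, b, t} \<times> UNIV" unfolding both_flags by auto
  finally show ?thesis .
qed

lemma R3_boundary:
  fixes a1 a2 a3 b1 b2 b3 t1 t2 t3 :: 'e
  assumes labels: "distinct [a2, b2, t2]"
    and below: "end_disjoint {crossing h' a1 t2 a2 t1 da (\<not> dt), crossing h' b1 t3 b2 t2 db (\<not> dt),
         crossing h a2 b2 a3 b3 da db}"
    and above: "end_disjoint {crossing h a1 b1 a2 b2 da db, crossing h' b2 t2 b3 t1 db (\<not> dt),
         crossing h' a2 t3 a3 t2 da (\<not> dt)}"
  shows "{a1, a3, b1, b3, t1, t3} \<inter> {a2, b2, t2} = {}"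
proof -
  note end_simps = ends_crossing not_not
  have "{(a1, da), (b1, db), (t1, dt), (a3, \<not> da), (b3, \<not> db), (t3, \<not> dt)} \<inter>
      {(a2, da), (a2, \<not> da), (b2, db), (b2, \<not> db), (t2, dt), (t2, \<not> dt)} = {}"
  proof (rule triangle_sides_disjoint)
    show "distinct [(a2, da), (a2, \<not> da), (b2, db), (b2, \<not> db), (t2, dt), (t2, \<not> dt)]"
      using labels by simp
    show "pairwise disjnt {{(a1, da), (t2, \<not> dt), (a2, \<not> da), (t1, dt)},
        {(b1, db), (t3, \<not> dt), (b2, \<not> db), (t2, dt)}, {(a2, da), (b2, db), (a3, \<not> da), (b3, \<not> db)}}"
      using end_disjoint_pairwise[OF below] by (simp only: image_insert image_empty end_simps)
    show "pairwise disjnt {{(a1, da), (b1, db), (a2, \<not> da), (b2, \<not> db)},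
        {(b2, db), (t2, \<not> dt), (b3, \<not> db), (t1, dt)}, {(a2, da), (t3, \<not> dt), (a3, \<not> da), (t2, dt)}}"
      using end_disjoint_pairwise[OF above] by (simp only: image_insert image_empty end_simps)
  qed (use below above in \<open>simp_all only: end_disjoint_def ball_simps end_simps\<close>)
  then show ?thesis
    unfolding both_flags3 by simp
qed

text \<open>The two crossings on the side with three nodes cannot coincide, as a rotation matching them
  would identify \<open>a2\<close> with \<open>b2\<close> or reverse the moving strand, and a crossing
  is not a vertex. So all ends on this side are different.\<close>

lemma pass_boundary:
  fixes a1 a2 b1 b2 c1 t1 t2 t3 :: 'e
  assumes labels: "distinct [a2, b2, t2]" and flags: "no_source_sink da db dc"
    and below: "end_disjoint {crossing h a1 t2 a2 t1 da (\<not> dt), crossing h b1 t3 b2 t2 db (\<not> dt),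
         vertex (a2, da) (b2, db) (c1, dc)}"
  shows "{a1, b1, c1, t1, t3} \<inter> {a2, b2, t2} = {}"
proof -
  obtain at bt v where nodes: "at = crossing h a1 t2 a2 t1 da (\<not> dt)"
      "bt = crossing h b1 t3 b2 t2 db (\<not> dt)" "v = vertex (a2, da) (b2, db) (c1, dc)"
    by blast
  have ends: "set (ends at) = {(a1, da), (t2, \<not> dt), (a2, \<not> da), (t1, dt)}"
      "set (ends bt) = {(b1, db), (t3, \<not> dt), (b2, \<not> db), (t2, dt)}"
      "set (ends v) = {(a2, da), (b2, db), (c1, dc)}"
    unfolding nodes by (simp_all only: ends_crossing ends_vertex[OF flags] not_not)
  have dist: "distinct [(a1, da), (t2, \<not> dt), (a2, \<not> da), (t1, dt)]"
      "distinct [(b1, db), (t3, \<not> dt), (b2, \<not> db), (t2, dt)]"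
      "distinct [(a2, da), (b2, db), (c1, dc)]"
    using below by (simp_all only: end_disjoint_def ball_simps ends_crossing ends_vertex[OF flags] not_not)
  have "at \<noteq> bt"
    using labels unfolding nodes by (cases h; cases da; cases db; cases dt; simp)
  moreover have "at \<noteq> v" "bt \<noteq> v"
    unfolding nodes by (rule crossing_neq_vertex)+
  ultimately have disj: "set (ends at) \<inter> set (ends bt) = {}" "set (ends at) \<inter> set (ends v) = {}"
      "set (ends bt) \<inter> set (ends v) = {}"
    using below unfolding end_disjoint_def nodes by blast+
  have opaque: "{a, b, c, t, t'} \<inter> {A, A', B, B', T, T'} = {}"
    if "distinct [A, A', B, B', T, T']" "distinct [a, T', A', t]" "distinct [b, t', B', T]" "distinct [A, B, c]"
      "{a, T', A', t} \<inter> {b, t', B', T} = {}" "{a, T', A', t} \<inter> {A, B, c} = {}"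
      "{b, t', B', T} \<inter> {A, B, c} = {}" for a b c t t' A A' B B' T T' :: "'e \<times> bool"
    using that by (simp add: eq_commute)
  have "distinct [(a2, da), (a2, \<not> da), (b2, db), (b2, \<not> db), (t2, dt), (t2, \<not> dt)]"
    using labels by simp
  from opaque[OF this dist disj[unfolded ends]] show ?thesis
    unfolding both_flags3 by simp
qed

text \<open>\<open>Vertex\<close> lists the two like edges first, so a vertex remembers its edges up to
  rotation.\<close>

lemma vertex_eq:
  assumes "no_source_sink d1 d2 d3" "no_source_sink d1' d2' d3'"
    and "vertex (e1, d1) (e2, d2) (e3, d3) = vertex (e1', d1') (e2', d2') (e3', d3')"
  shows "[(e1, d1), (e2, d2), (e3, d3)] \<in> {[(e1', d1'), (e2', d2'), (e3', d3')],
     [(e2', d2'), (e3', d3'), (e1', d1')], [(e3', d3'), (e1', d1'), (e2', d2')]}"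
  using assms unfolding no_source_sink_def
  by (cases d1; cases d2; cases d3; cases d1'; cases d2'; cases d3'; simp)

text \<open>If the two vertices on one side coincided, matching them up to rotation would identify the
  ends at \<open>w\<close> and \<open>z\<close> or those at \<open>x\<close> and \<open>y\<close>, which
  are different ends of a vertex on the other side.\<close>

lemma IH_boundary:
  assumes flags: "no_source_sink dw dx (\<not> up)" "no_source_sink up dy dz"
    "no_source_sink dw (\<not> right) dz" "no_source_sink right dx dy"
    and vert: "end_disjoint {vertex (w, dw) (x, dx) (k, \<not> up), vertex (k, up) (y, dy) (z, dz)}"
    and hori: "end_disjoint {vertex (w, dw) (k, \<not> right) (z, dz), vertex (k, right) (x, dx) (y, dy)}"
  shows "k \<notin> {w, x, y, z}"
proof -
  have dist: "distinct [(w, dw), (x, dx), (k, \<not> up)]" "distinct [(k, up), (y, dy), (z, dz)]"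
    using vert by (simp_all only: end_disjoint_def ball_simps ends_vertex flags)
  have dist': "distinct [(w, dw), (k, \<not> right), (z, dz)]" "distinct [(k, right), (x, dx), (y, dy)]"
    using hori by (simp_all only: end_disjoint_def ball_simps ends_vertex flags)
  have "vertex (w, dw) (x, dx) (k, \<not> up) \<noteq> vertex (k, up) (y, dy) (z, dz)"
  proof
    assume "vertex (w, dw) (x, dx) (k, \<not> up) = vertex (k, up) (y, dy) (z, dz)"
    from vertex_eq[OF flags(1,2) this] have "(w, dw) = (z, dz) \<or> (x, dx) = (y, dy)"
      by auto
    then show False using dist' by auto
  qed
  then have "{(w, dw), (x, dx), (k, \<not> up)} \<inter> {(k, up), (y, dy), (z, dz)} = {}"
    using vert by (simp only: end_disjoint_def ball_simps ends_vertex flags) blast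
  then show ?thesis using dist by (cases up) auto
qed

section \<open>Colorings of a glued diagram\<close>

definition local_coloring ::
  "('x \<Rightarrow> 'x \<Rightarrow> 'x) \<Rightarrow> ('x \<Rightarrow> 'x \<Rightarrow> 'x) \<Rightarrow> ('x \<times> 'x) set \<Rightarrow> ('x \<Rightarrow> 'x \<Rightarrow> 'x) \<Rightarrow>
    tangle \<Rightarrow> (nat \<Rightarrow> 'x) \<Rightarrow> bool" where
  "local_coloring u v D m T c \<longleftrightarrow>
     (\<forall>n\<in>inner_nodes T. node_coloring u v D m c n) \<and> (\<forall>(e, e')\<in>through T. c e = c e')"

lemma equiv_closure_constant:
  assumes "\<forall>(e, e')\<in>r. c e = c e'" "(e, e') \<in> equiv_closure r"
  shows "c e = c e'"
  using assms(2) unfolding equiv_closure_def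
  by (induction rule: rtrancl_induct) (use assms(1) in auto)

text \<open>Pulling a coloring back along the relabelling \<open>f\<close> loses nothing, and the
  colorings obtained are those constant on the pieces that \<open>f\<close> identifies, which are the
  pieces joined by crossingless strands.\<close>

lemma colorings_glued:
  assumes glued: "is_glued L N T f \<Gamma>"
  shows "colorings u v D m \<Gamma> \<approx>
    {c \<in> (L \<union> interior T) \<rightarrow>\<^sub>E UNIV. (\<forall>n\<in>N. node_coloring u v D m c n) \<and> local_coloring u v D m T c}"
    (is "_ \<approx> ?C")
proof -
  define A where "A = L \<union> interior T"
  have arcs: "semiarcs \<Gamma> = f ` A" and nodes: "nodes \<Gamma> = map_node f ` (N \<union> inner_nodes T)"
    and f: "\<And>e e'. e \<in> A \<Longrightarrow> e' \<in> A \<Longrightarrow> f e = f e' \<longleftrightarrow> (e, e') \<in> equiv_closure (through T)"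
    and labels: "\<And>n. n \<in> N \<union> inner_nodes T \<Longrightarrow> set_node n \<subseteq> A"
    and through: "through T \<subseteq> A \<times> A"
    using glued unfolding is_glued_def A_def by auto
  define pull where "pull c = restrict (c \<circ> f) A" for c :: "nat \<Rightarrow> 'a"
  have pull_colored: "node_coloring u v D m (pull c) n \<longleftrightarrow> node_coloring u v D m c (map_node f n)"
    if "n \<in> N \<union> inner_nodes T" for c n
    unfolding node_coloring_map pull_def
    using labels[OF that] by (intro node_coloring_cong) auto
  have "bij_betw pull (colorings u v D m \<Gamma>) ?C"
    unfolding bij_betw_def
  proof (intro conjI subset_antisym subsetI)
    show "inj_on pull (colorings u v D m \<Gamma>)"
    proof (rule inj_onI)
      fix c c' assume c: "c \<in> colorings u v D m \<Gamma>" "c' \<in> colorings u v D m \<Gamma>" "pull c = pull c'"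
      have "c (f e) = c' (f e)" if "e \<in> A" for e
        using fun_cong[OF c(3), of e] that by (simp add: pull_def)
      then show "c = c'"
        using c(1,2) unfolding colorings_def arcs by (intro PiE_ext[of c "f ` A" "\<lambda>_. UNIV" c']) auto
    qed
  next
    fix c assume "c \<in> pull ` colorings u v D m \<Gamma>"
    then obtain c0 where c0: "c0 \<in> colorings u v D m \<Gamma>" "c = pull c0" by blast
    have "c e = c e'" if "(e, e') \<in> through T" for e e'
    proof -
      have "f e = f e'"
        using f that through by (auto simp: equiv_closure_def)
      then show ?thesis using that through by (auto simp: c0(2) pull_def)
    qed
    moreover have "node_coloring u v D m c n" if "n \<in> N \<union> inner_nodes T" for n
      using c0 that pull_colored unfolding colorings_def nodes by blast
    ultimately show "c \<in> ?C"
      unfolding local_coloring_def by (auto simp: c0(2) pull_def A_def)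
  next
    fix c assume c: "c \<in> ?C"
    define c0 where "c0 = restrict (\<lambda>e. c (inv_into A f e)) (semiarcs \<Gamma>)"
    have c0f: "c0 (f e) = c e" if "e \<in> A" for e
    proof -
      have "inv_into A f (f e) \<in> A" "f (inv_into A f (f e)) = f e"
        using that by (auto intro: inv_into_into f_inv_into_f)
      then have "(inv_into A f (f e), e) \<in> equiv_closure (through T)" using f that by blast
      then have "c (inv_into A f (f e)) = c e"
        using c equiv_closure_constant[of "through T" c] unfolding local_coloring_def by blast
      then show ?thesis using that by (simp add: c0_def arcs)
    qed
    have pull: "pull c0 = c"
    proof
      fix e show "pull c0 e = c e"
        using c0f[of e] c by (auto simp: pull_def A_def PiE_def extensional_def)
    qed
    have "node_coloring u v D m c0 n'" if n': "n' \<in> nodes \<Gamma>" for n'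
    proof -
      obtain n where n: "n \<in> N \<union> inner_nodes T" "n' = map_node f n" using n' nodes by blast
      then have "node_coloring u v D m c n" using c unfolding local_coloring_def by blast
      then show ?thesis using pull_colored[OF n(1), of c0] pull n(2) by simp
    qed
    then have "c0 \<in> colorings u v D m \<Gamma>"
      unfolding colorings_def by (auto simp: c0_def)
    then show "c \<in> pull ` colorings u v D m \<Gamma>" using pull by blast
  qed
  then show ?thesis unfolding eqpoll_def by blast
qed

text \<open>The following two notions split the bijection between the colorings of two tangles into
  existence and uniqueness, so that neither side has to be described by explicit boundary colors.\<close>

definition extends_over :: "(('e \<Rightarrow> 'x) \<Rightarrow> bool) \<Rightarrow> (('e \<Rightarrow> 'x) \<Rightarrow> bool) \<Rightarrow> 'e set \<Rightarrow> bool" where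
  "extends_over P Q L \<longleftrightarrow> (\<forall>c. P c \<longrightarrow> (\<exists>c'. Q c' \<and> (\<forall>e\<in>L. c' e = c e)))"

definition rigid :: "(('e \<Rightarrow> 'x) \<Rightarrow> bool) \<Rightarrow> 'e set \<Rightarrow> 'e set \<Rightarrow> bool" where
  "rigid P L I \<longleftrightarrow> (\<forall>c c'. P c \<longrightarrow> P c' \<longrightarrow> (\<forall>e\<in>L. c e = c' e) \<longrightarrow> (\<forall>e\<in>I. c e = c' e))"

lemma local_coloring_cong:
  assumes "\<And>n. n \<in> inner_nodes T \<Longrightarrow> set_node n \<subseteq> A" "through T \<subseteq> A \<times> A" "\<And>e. e \<in> A \<Longrightarrow> c e = c' e"
  shows "local_coloring u v D m T c \<longleftrightarrow> local_coloring u v D m T c'"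
proof -
  have "node_coloring u v D m c n \<longleftrightarrow> node_coloring u v D m c' n" if "n \<in> inner_nodes T" for n
    using assms(1)[OF that] assms(3) by (intro node_coloring_cong) blast
  moreover have "c e = c' e \<and> c e' = c' e'" if "(e, e') \<in> through T" for e e'
    using assms(2,3) that by blast
  ultimately show ?thesis unfolding local_coloring_def by fastforce
qed

definition same_boundary_colorings ::
  "('x \<Rightarrow> 'x \<Rightarrow> 'x) \<Rightarrow> ('x \<Rightarrow> 'x \<Rightarrow> 'x) \<Rightarrow> ('x \<times> 'x) set \<Rightarrow> ('x \<Rightarrow> 'x \<Rightarrow> 'x) \<Rightarrow>
    nat set \<Rightarrow> tangle \<Rightarrow> tangle \<Rightarrow> bool" where
  "same_boundary_colorings u v D m L T T' \<longleftrightarrow>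
     rigid (local_coloring u v D m T) L (interior T) \<and>
     rigid (local_coloring u v D m T') L (interior T') \<and>
     extends_over (local_coloring u v D m T) (local_coloring u v D m T') L \<and>
     extends_over (local_coloring u v D m T') (local_coloring u v D m T) L"

lemma same_boundary_colorings_sym: "same_boundary_colorings u v D m L T T' \<Longrightarrow> same_boundary_colorings u v D m L T' T"
  by (simp add: same_boundary_colorings_def)

text \<open>Restriction to \<open>L\<close> is injective on the colorings of either diagram by rigidity.
  The two images agree, since the nodes outside the disc only see the labels in \<open>L\<close>, and a
  coloring of one tangle may be replaced by one of the other there.\<close>

lemma colorings_eqpoll:
  assumes glued: "is_glued L N T f \<Gamma>" "is_glued L N T' f' \<Gamma>'"
    and "same_boundary_colorings u v D m L T T'"
  shows "colorings u v D m \<Gamma> \<approx> colorings u v D m \<Gamma>'"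
proof -
  have rigid: "rigid (local_coloring u v D m T) L (interior T)"
      "rigid (local_coloring u v D m T') L (interior T')"
    and extends: "extends_over (local_coloring u v D m T) (local_coloring u v D m T') L"
      "extends_over (local_coloring u v D m T') (local_coloring u v D m T) L"
    using assms(3) unfolding same_boundary_colorings_def by blast+
  define C where "C T = {c \<in> (L \<union> interior T) \<rightarrow>\<^sub>E UNIV. (\<forall>n\<in>N. node_coloring u v D m c n) \<and>
    local_coloring u v D m T c}" for T
  have restrict_eqpoll: "C T \<approx> (\<lambda>c. restrict c L) ` C T"
    if "rigid (local_coloring u v D m T) L (interior T)" for T
  proof -
    have "inj_on (\<lambda>c. restrict c L) (C T)"
    proof (rule inj_onI)
      fix c c' assume c: "c \<in> C T" "c' \<in> C T" "restrict c L = restrict c' L"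
      then have "\<forall>e\<in>L. c e = c' e" by (metis restrict_apply')
      moreover from this have "\<forall>e\<in>interior T. c e = c' e"
        using that c(1,2) unfolding rigid_def C_def by blast
      ultimately show "c = c'"
        using c(1,2) unfolding C_def by (intro PiE_ext[of c "L \<union> interior T" "\<lambda>_. UNIV" c']) auto
    qed
    then show ?thesis by (simp add: inj_on_image_eqpoll_self eqpoll_sym)
  qed
  have image_subset: "(\<lambda>c. restrict c L) ` C T \<subseteq> (\<lambda>c. restrict c L) ` C T'"
    if glued': "is_glued L N T' f' \<Gamma>'" and extends': "extends_over (local_coloring u v D m T) (local_coloring u v D m T') L"
    for T T' f' \<Gamma>'
  proof
    fix b assume "b \<in> (\<lambda>c. restrict c L) ` C T"
    then obtain c where c: "c \<in> C T" "b = restrict c L" by blast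
    then obtain c' where c': "local_coloring u v D m T' c'" "\<forall>e\<in>L. c' e = c e"
      using extends' unfolding extends_over_def C_def by blast
    define c'' where "c'' = restrict c' (L \<union> interior T')"
    have "local_coloring u v D m T' c''"
    proof -
      have "through T' \<subseteq> (L \<union> interior T') \<times> (L \<union> interior T')"
        using glued' unfolding is_glued_def by auto
      moreover have "set_node n \<subseteq> L \<union> interior T'" if "n \<in> inner_nodes T'" for n
        using glued' that unfolding is_glued_def by blast
      moreover have "c' e = c'' e" if "e \<in> L \<union> interior T'" for e
        using that by (simp only: c''_def restrict_apply if_True)
      ultimately show ?thesis
        using c'(1) local_coloring_cong[of T' "L \<union> interior T'" c' c''] by blast
    qed
    moreover have "node_coloring u v D m c'' n" if n: "n \<in> N" for n
    proof -
      have "node_coloring u v D m c n" using c(1) n unfolding C_def by blast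
      moreover have "c e = c'' e" if "e \<in> set_node n" for e
      proof -
        have "e \<in> L" using that glued' n unfolding is_glued_def by auto
        then show ?thesis using c'(2) by (simp add: c''_def)
      qed
      ultimately show ?thesis using node_coloring_cong by metis
    qed
    ultimately have "c'' \<in> C T'" unfolding C_def c''_def by auto
    moreover have "b = restrict c'' L" using c(2) c'(2) by (auto simp: c''_def)
    ultimately show "b \<in> (\<lambda>c. restrict c L) ` C T'" by blast
  qed
  have "(\<lambda>c. restrict c L) ` C T = (\<lambda>c. restrict c L) ` C T'"
    using image_subset[OF glued(2) extends(1)] image_subset[OF glued(1) extends(2)] by blast
  then have "C T \<approx> C T'"
    using restrict_eqpoll[OF rigid(1)] restrict_eqpoll[OF rigid(2)] eqpoll_sym eqpoll_trans by metis
  moreover have "colorings u v D m \<Gamma> \<approx> C T" "colorings u v D m \<Gamma>' \<approx> C T'"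
    unfolding C_def using glued colorings_glued by blast+
  ultimately show ?thesis using eqpoll_sym eqpoll_trans by metis
qed

text \<open>Without crossingless strands the relabelling is injective, so different nodes of the tangle
  give different nodes of the diagram.\<close>

lemma glued_end_disjoint:
  assumes "is_diagram \<Gamma>" "is_glued L N T f \<Gamma>" "through T = {}"
  shows "end_disjoint (inner_nodes T)"
proof (rule end_disjoint_map)
  have "map_node f ` inner_nodes T \<subseteq> nodes \<Gamma>" using assms(2) unfolding is_glued_def by blast
  then show "end_disjoint (map_node f ` inner_nodes T)"
    using assms(1) unfolding is_diagram_def end_disjoint_def by blast
  show "inj_on f (L \<union> interior T)"
    using assms(2,3) unfolding is_glued_def by (auto simp: inj_on_def equiv_closure_def)
  show "set_node n \<subseteq> L \<union> interior T" if "n \<in> inner_nodes T" for n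
    using assms(2) that unfolding is_glued_def by blast
qed

section \<open>The moves\<close>

context partially_multiplicative_biquandle
begin

abbreviation colored :: "('e \<Rightarrow> 'x) \<Rightarrow> 'e node \<Rightarrow> bool" where
  "colored c n \<equiv> node_coloring utri otri D mult c n"

lemma colored_crossing:
  "colored c (crossing h e1 e2 e3 e4 p q) \<longleftrightarrow> sided_cross h q p (c e3) (c e1) (c e2) (c e4)"
  by (cases h; cases p; cases q; auto simp: sided_cross_def cross_def tri_def Let_def)

lemma colored_vertex:
  "colored c (vertex (e1, d1) (e2, d2) (e3, d3)) \<longleftrightarrow> vertex_colors d1 d2 d3 (c e1) (c e2) (c e3)"
  by (auto simp: is_product_def)

declare crossing.simps [simp del] vertex.simps [simp del] vertex_colors.simps [simp del]

abbreviation coloring :: "tangle \<Rightarrow> (nat \<Rightarrow> 'x) \<Rightarrow> bool" where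
  "coloring \<equiv> local_coloring utri otri D mult"

abbreviation exchangeable :: "nat set \<Rightarrow> tangle \<Rightarrow> tangle \<Rightarrow> bool" where
  "exchangeable \<equiv> same_boundary_colorings utri otri D mult"

lemmas coloring_simps = local_coloring_def colored_crossing colored_vertex

lemma R1_exchangeable:
  assumes "k \<notin> L" "a \<in> L" "b \<in> L"
  shows "exchangeable L
    \<lparr>interior = {k}, inner_nodes = {crossing h a k k b da da}, through = {}\<rparr>
    \<lparr>interior = {}, inner_nodes = {}, through = {(a, b)}\<rparr>" (is "exchangeable L ?T ?T'")
  unfolding same_boundary_colorings_def
proof (intro conjI)
  have T: "coloring ?T c \<longleftrightarrow> sided_cross h da da (c k) (c a) (c k) (c b)"
    and T': "coloring ?T' c \<longleftrightarrow> c a = c b" for c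
    by (simp_all add: coloring_simps)
  show "rigid (coloring ?T) L (interior ?T)"
    unfolding rigid_def T using assms sided_cross_kink_loop sided_cross_kink_loop_unique
    by simp metis
  show "rigid (coloring ?T') L (interior ?T')" by (simp add: rigid_def)
  show "extends_over (coloring ?T) (coloring ?T') L"
    unfolding extends_over_def T T' using sided_cross_kink_loop by blast
  show "extends_over (coloring ?T') (coloring ?T) L"
    unfolding extends_over_def T T'
  proof (intro allI impI)
    fix c :: "nat \<Rightarrow> 'x" assume "c a = c b"
    then obtain x where "sided_cross h da da x (c a) x (c b)"
      using sided_cross_kink_loop_exists by metis
    then show "\<exists>c'. sided_cross h da da (c' k) (c' a) (c' k) (c' b) \<and> (\<forall>e\<in>L. c' e = c e)"
      using assms by (intro exI[of _ "c(k := x)"]) auto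
  qed
qed

text \<open>Read from the bigon outwards, both crossings state the same relation between the inner
  colors at \<open>a2\<close> and \<open>b2\<close> and the outer ones. So the colors at the bottom
  agree with those at the top, and they determine the inner ones.\<close>

lemma R2_exchangeable:
  assumes "a2 \<noteq> b2" "{a2, b2} \<inter> L = {}" "{a1, a3, b1, b3} \<subseteq> L"
  shows "exchangeable L
      \<lparr>interior = {a2, b2},
       inner_nodes = {crossing h b1 a2 b2 a1 db (\<not> da), crossing h b2 a2 b3 a3 db da},
       through = {}\<rparr>
      \<lparr>interior = {}, inner_nodes = {}, through = {(a1, a3), (b1, b3)}\<rparr>"
    (is "exchangeable L ?T ?T'")
  unfolding same_boundary_colorings_def
proof (intro conjI)
  have outer: "a1 \<notin> {a2, b2}" "a3 \<notin> {a2, b2}" "b1 \<notin> {a2, b2}" "b3 \<notin> {a2, b2}"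
    "\<And>e. e \<in> L \<Longrightarrow> e \<notin> {a2, b2}"
    using assms(2,3) by blast+
  have T: "coloring ?T c \<longleftrightarrow> sided_cross h (\<not> da) db (c b2) (c b1) (c a2) (c a1) \<and>
      sided_cross h (\<not> da) db (c b2) (c b3) (c a2) (c a3)"
    and T': "coloring ?T' c \<longleftrightarrow> c a1 = c a3 \<and> c b1 = c b3" for c
    by (simp_all add: coloring_simps sided_cross_flip1[of h da])
  show "rigid (coloring ?T) L (interior ?T)"
    unfolding rigid_def T using assms sided_cross_corner4 by simp metis
  show "rigid (coloring ?T') L (interior ?T')" by (simp add: rigid_def)
  show "extends_over (coloring ?T) (coloring ?T') L"
    unfolding extends_over_def T T' using sided_cross_unique by blast
  show "extends_over (coloring ?T') (coloring ?T) L"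
    unfolding extends_over_def T T'
  proof (intro allI impI)
    fix c :: "nat \<Rightarrow> 'x" assume c: "c a1 = c a3 \<and> c b1 = c b3"
    obtain y x where "sided_cross h da (\<not> db) (c b1) y (c a1) x"
      using sided_cross_exists by blast
    then have "sided_cross h (\<not> da) db y (c b1) x (c a1)"
      using sided_cross_flip1 sided_cross_flip2 by metis
    then show "\<exists>c'. (sided_cross h (\<not> da) db (c' b2) (c' b1) (c' a2) (c' a1) \<and>
      sided_cross h (\<not> da) db (c' b2) (c' b3) (c' a2) (c' a3)) \<and> (\<forall>e\<in>L. c' e = c e)"
      using assms(1) outer c by (intro exI[of _ "c(b2 := y, a2 := x)"]) simp
  qed
qed

text \<open>Both sides are brought into the form of \<open>sided_cross_cube\<close> for the strands
  \<open>a, b, t\<close>. On one side the edges \<open>a2, b2, t2\<close> are the given corner of the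
  cube, on the other one they are the opposite corner.\<close>

lemma R3_exchangeable:
  assumes "distinct [a2, b2, t2]" "{a2, b2, t2} \<inter> L = {}" "{a1, a3, b1, b3, t1, t3} \<subseteq> L"
  shows "exchangeable L
      \<lparr>interior = {a2, b2, t2},
       inner_nodes = {crossing h' a1 t2 a2 t1 da (\<not> dt), crossing h' b1 t3 b2 t2 db (\<not> dt),
         crossing h a2 b2 a3 b3 da db},
       through = {}\<rparr>
      \<lparr>interior = {a2, b2, t2},
       inner_nodes = {crossing h a1 b1 a2 b2 da db, crossing h' b2 t2 b3 t1 db (\<not> dt),
         crossing h' a2 t3 a3 t2 da (\<not> dt)},
       through = {}\<rparr>"
    (is "exchangeable L ?T ?T'")
  unfolding same_boundary_colorings_def
proof (intro conjI)
  define P where "P c \<longleftrightarrow> sided_cross h' (\<not> dt) da (c a2) (c a1) (c t2) (c t1) \<and>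
      sided_cross h' (\<not> dt) (\<not> db) (c b2) (c b1) (c t2) (c t3) \<and>
      sided_cross h (\<not> db) da (c a2) (c a3) (c b2) (c b3)" for c :: "nat \<Rightarrow> 'x"
  define Q where "Q c \<longleftrightarrow> sided_cross h (\<not> db) da (c a1) (c a2) (c b1) (c b2) \<and>
      sided_cross h' (\<not> dt) (\<not> db) (c b3) (c b2) (c t1) (c t2) \<and>
      sided_cross h' (\<not> dt) da (c a3) (c a2) (c t3) (c t2)" for c :: "nat \<Rightarrow> 'x"
  have outer: "a1 \<notin> {a2, b2, t2}" "a3 \<notin> {a2, b2, t2}" "b1 \<notin> {a2, b2, t2}" "b3 \<notin> {a2, b2, t2}"
    "t1 \<notin> {a2, b2, t2}" "t3 \<notin> {a2, b2, t2}" "\<And>e. e \<in> L \<Longrightarrow> e \<notin> {a2, b2, t2}"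
    using assms(2,3) by blast+
  have T: "coloring ?T c \<longleftrightarrow> P c" for c
    by (simp add: P_def coloring_simps sided_cross_flip1[of h db] sided_cross_flip2[of h' _ db])
  have T': "coloring ?T' c \<longleftrightarrow> Q c" for c
    by (simp add: Q_def coloring_simps sided_cross_flip1[of h db] sided_cross_flip2[of h' _ db])
  show "rigid (coloring ?T) L (interior ?T)"
    unfolding rigid_def T
  proof (intro allI impI)
    fix c c' :: "nat \<Rightarrow> 'x"
    assume c: "P c" and c': "P c'" and "\<forall>e\<in>L. c e = c' e"
    then have eq: "c a1 = c' a1" "c t1 = c' t1" "c b1 = c' b1" using assms by auto
    then have a2: "c a2 = c' a2" and t2: "c t2 = c' t2"
      using c c' unfolding P_def using sided_cross_corner4 by metis+
    then have "c b2 = c' b2"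
      using c c' eq unfolding P_def using sided_cross_corner3 by metis
    then show "\<forall>e\<in>interior ?T. c e = c' e" using a2 t2 by simp
  qed
  show "rigid (coloring ?T') L (interior ?T')"
    unfolding rigid_def T'
  proof (intro allI impI)
    fix c c' :: "nat \<Rightarrow> 'x"
    assume c: "Q c" and c': "Q c'" and "\<forall>e\<in>L. c e = c' e"
    then have eq: "c a1 = c' a1" "c t1 = c' t1" "c b1 = c' b1" using assms by auto
    then have a2: "c a2 = c' a2" and b2: "c b2 = c' b2"
      using c c' unfolding Q_def using sided_cross_unique by metis+
    then have "c t2 = c' t2"
      using c c' eq unfolding Q_def using sided_cross_corner3 by metis
    then show "\<forall>e\<in>interior ?T'. c e = c' e" using a2 b2 by simp
  qed
  show "extends_over (coloring ?T) (coloring ?T') L"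
    unfolding extends_over_def T T'
  proof (intro allI impI)
    fix c :: "nat \<Rightarrow> 'x"
    assume c: "P c"
    obtain x y z where xyz: "sided_cross h (\<not> db) da (c a1) x (c b1) y"
      "sided_cross h' (\<not> dt) da (c a3) x (c t3) z" "sided_cross h' (\<not> dt) (\<not> db) (c b3) y (c t1) z"
      using sided_cross_cube[of h "\<not> db" da "c a2" "c a3" "c b2" "c b3" h' "\<not> dt" "c a1" "c t2" "c t1"
        "c b1" "c t3"] c unfolding P_def by blast
    show "\<exists>c'. Q c' \<and> (\<forall>e\<in>L. c' e = c e)"
      using xyz assms(1) outer unfolding Q_def by (intro exI[of _ "c(a2 := x, b2 := y, t2 := z)"]) simp
  qed
  show "extends_over (coloring ?T') (coloring ?T) L"
    unfolding extends_over_def T T'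
  proof (intro allI impI)
    fix c :: "nat \<Rightarrow> 'x"
    assume c: "Q c"
    have flip: "sided_cross g s r u u' w w' \<longleftrightarrow> sided_cross g (\<not> s) (\<not> r) u' u w' w" for g s r u u' w w'
      using sided_cross_flip1 sided_cross_flip2 by blast
    obtain x y z where xyz: "sided_cross h (\<not> \<not> db) (\<not> da) (c a3) x (c b3) y"
      "sided_cross h' (\<not> \<not> dt) (\<not> da) (c a1) x (c t1) z" "sided_cross h' (\<not> \<not> dt) (\<not> \<not> db) (c b1) y (c t3) z"
      using sided_cross_cube[of h "\<not> \<not> db" "\<not> da" "c a2" "c a1" "c b2" "c b1" h' "\<not> \<not> dt" "c a3" "c t2" "c t3"
         "c b3" "c t1"] c flip unfolding Q_def by blast
    have "sided_cross h (\<not> db) da x (c a3) y (c b3)"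
      "sided_cross h' (\<not> dt) da x (c a1) z (c t1)" "sided_cross h' (\<not> dt) (\<not> db) y (c b1) z (c t3)"
      using xyz by (simp_all only: flip[symmetric])
    then show "\<exists>c'. P c' \<and> (\<forall>e\<in>L. c' e = c e)"
      using assms(1) outer unfolding P_def by (intro exI[of _ "c(a2 := x, b2 := y, t2 := z)"]) simp
  qed
qed

lemma twist_exchangeable:
  assumes "a2 \<noteq> b2" "no_source_sink da db dc" "{a2, b2} \<inter> L = {}" "{a, b, c1} \<subseteq> L"
  shows "exchangeable L
      \<lparr>interior = {a2, b2},
       inner_nodes = {crossing h a b a2 b2 da db, vertex (b2, db) (a2, da) (c1, dc)},
       through = {}\<rparr>
      \<lparr>interior = {}, inner_nodes = {vertex (a, da) (b, db) (c1, dc)}, through = {}\<rparr>"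
    (is "exchangeable L ?T ?T'")
  unfolding same_boundary_colorings_def
proof (intro conjI)
  have outer: "a \<notin> {a2, b2}" "b \<notin> {a2, b2}" "c1 \<notin> {a2, b2}"
    "\<And>e. e \<in> L \<Longrightarrow> e \<notin> {a2, b2}"
    using assms(3,4) by blast+
  have T: "coloring ?T c \<longleftrightarrow> sided_cross h db da (c a2) (c a) (c b) (c b2) \<and>
      vertex_colors da db dc (c a) (c b) (c c1)"
    and T': "coloring ?T' c \<longleftrightarrow> vertex_colors da db dc (c a) (c b) (c c1)" for c
    using twist_colors[OF assms(2)] by (auto simp: coloring_simps)
  show "rigid (coloring ?T) L (interior ?T)"
    unfolding rigid_def T using assms sided_cross_corner3 by simp metis
  show "rigid (coloring ?T') L (interior ?T')" by (simp add: rigid_def)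
  show "extends_over (coloring ?T) (coloring ?T') L"
    unfolding extends_over_def T T' by blast
  show "extends_over (coloring ?T') (coloring ?T) L"
    unfolding extends_over_def T T'
  proof (intro allI impI)
    fix c :: "nat \<Rightarrow> 'x" assume c: "vertex_colors da db dc (c a) (c b) (c c1)"
    obtain x y where "sided_cross h (\<not> db) da (c a) x (c b) y"
      using sided_cross_exists by blast
    then have "sided_cross h db da x (c a) (c b) y"
      using sided_cross_flip1 by blast
    then show "\<exists>c'. (sided_cross h db da (c' a2) (c' a) (c' b) (c' b2) \<and>
      vertex_colors da db dc (c' a) (c' b) (c' c1)) \<and> (\<forall>e\<in>L. c' e = c e)"
      using assms(1) outer c by (intro exI[of _ "c(a2 := x, b2 := y)"]) simp
  qed
qed

lemma pass_exchangeable: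
  assumes "distinct [a2, b2, t2]" "no_source_sink da db dc" "{a2, b2, t2} \<inter> L = {}" "c2 \<notin> L"
    "{a1, b1, c1, t1, t3} \<subseteq> L"
  shows "exchangeable L
      \<lparr>interior = {a2, b2, t2},
       inner_nodes = {crossing h a1 t2 a2 t1 da (\<not> dt), crossing h b1 t3 b2 t2 db (\<not> dt),
         vertex (a2, da) (b2, db) (c1, dc)},
       through = {}\<rparr>
      \<lparr>interior = {c2},
       inner_nodes = {vertex (a1, da) (b1, db) (c2, dc), crossing h c2 t3 c1 t1 (\<not> dc) (\<not> dt)},
       through = {}\<rparr>"
    (is "exchangeable L ?T ?T'")
  unfolding same_boundary_colorings_def
proof (intro conjI)
  define P where "P c \<longleftrightarrow> sided_cross h (\<not> dt) da (c a2) (c a1) (c t2) (c t1) \<and>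
      sided_cross h (\<not> dt) db (c b2) (c b1) (c t3) (c t2) \<and>
      vertex_colors da db dc (c a2) (c b2) (c c1)" for c :: "nat \<Rightarrow> 'x"
  define Q where "Q c \<longleftrightarrow> vertex_colors da db dc (c a1) (c b1) (c c2) \<and>
      sided_cross h (\<not> dt) (\<not> dc) (c c1) (c c2) (c t3) (c t1)" for c :: "nat \<Rightarrow> 'x"
  have outer: "a1 \<notin> {a2, b2, t2}" "b1 \<notin> {a2, b2, t2}" "c1 \<notin> {a2, b2, t2}"
    "t1 \<notin> {a2, b2, t2}" "t3 \<notin> {a2, b2, t2}" "\<And>e. e \<in> L \<Longrightarrow> e \<notin> {a2, b2, t2}"
    using assms(3,5) by blast+
  have T: "coloring ?T c \<longleftrightarrow> P c"
    and T': "coloring ?T' c \<longleftrightarrow> Q c" for c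
    by (simp_all add: P_def Q_def coloring_simps)
  show "rigid (coloring ?T) L (interior ?T)"
    unfolding rigid_def T
  proof (intro allI impI)
    fix c c' :: "nat \<Rightarrow> 'x"
    assume c: "P c" and c': "P c'" and "\<forall>e\<in>L. c e = c' e"
    then have eq: "c a1 = c' a1" "c t1 = c' t1" "c b1 = c' b1" using assms by auto
    then have a2: "c a2 = c' a2" and t2: "c t2 = c' t2"
      using c c' unfolding P_def using sided_cross_corner4 by metis+
    then have "c b2 = c' b2" using c c' eq unfolding P_def using sided_cross_corner4 by metis
    then show "\<forall>e\<in>interior ?T. c e = c' e" using a2 t2 by simp
  qed
  show "rigid (coloring ?T') L (interior ?T')"
    unfolding rigid_def T' Q_def using assms(5) vertex_colors_unique by simp metis
  show "extends_over (coloring ?T) (coloring ?T') L"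
    unfolding extends_over_def T T'
  proof (intro allI impI)
    fix c :: "nat \<Rightarrow> 'x"
    assume "P c"
    then obtain x where "vertex_colors da db dc (c a1) (c b1) x"
        "sided_cross h (\<not> dt) (\<not> dc) (c c1) x (c t3) (c t1)"
      using pass_colors_two[OF assms(2)] unfolding P_def by blast
    then show "\<exists>c'. Q c' \<and> (\<forall>e\<in>L. c' e = c e)"
      using assms(4,5) unfolding Q_def by (intro exI[of _ "c(c2 := x)"]) auto
  qed
  show "extends_over (coloring ?T') (coloring ?T) L"
    unfolding extends_over_def T T'
  proof (intro allI impI)
    fix c :: "nat \<Rightarrow> 'x"
    assume c: "Q c"
    then have "sided_cross h (\<not> \<not> dt) (\<not> dc) (c c2) (c c1) (c t3) (c t1)"
      unfolding Q_def using sided_cross_flip1 by blast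
    then obtain x y z where "vertex_colors da db dc x y (c c1)"
        "sided_cross h (\<not> \<not> dt) da (c a1) x z (c t1)" "sided_cross h (\<not> \<not> dt) db (c b1) y (c t3) z"
      using pass_colors_one[OF assms(2)] c unfolding Q_def by blast
    then have "vertex_colors da db dc x y (c c1)"
        "sided_cross h (\<not> dt) da x (c a1) z (c t1)" "sided_cross h (\<not> dt) db y (c b1) (c t3) z"
      by (simp_all only: sided_cross_flip1[symmetric])
    then show "\<exists>c'. P c' \<and> (\<forall>e\<in>L. c' e = c e)"
      using assms(1) outer unfolding P_def by (intro exI[of _ "c(a2 := x, b2 := y, t2 := z)"]) simp
  qed
qed

text \<open>The two sides differ by a quarter turn, so one implication for the colors, applied to the
  rotated boundary, gives the other one.\<close>

lemma IH_exchangeable: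
  assumes flags: "no_source_sink dw dx (\<not> up)" "no_source_sink up dy dz"
    "no_source_sink dw (\<not> right) dz" "no_source_sink right dx dy"
    and "k \<notin> L" "{w, x, y, z} \<subseteq> L"
  shows "exchangeable L
      \<lparr>interior = {k},
       inner_nodes = {vertex (w, dw) (x, dx) (k, \<not> up), vertex (k, up) (y, dy) (z, dz)},
       through = {}\<rparr>
      \<lparr>interior = {k},
       inner_nodes = {vertex (w, dw) (k, \<not> right) (z, dz), vertex (k, right) (x, dx) (y, dy)},
       through = {}\<rparr>"
    (is "exchangeable L ?T ?T'")
  unfolding same_boundary_colorings_def
proof (intro conjI)
  have T: "coloring ?T c \<longleftrightarrow> vertex_colors dw dx (\<not> up) (c w) (c x) (c k) \<and>
      vertex_colors up dy dz (c k) (c y) (c z)" for c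
    by (simp add: coloring_simps)
  have T': "coloring ?T' c \<longleftrightarrow> vertex_colors dw (\<not> right) dz (c w) (c k) (c z) \<and>
      vertex_colors right dx dy (c k) (c x) (c y)" for c
    by (simp add: coloring_simps)
  have rotated: "vertex_colors dw (\<not> right) dz p q r \<longleftrightarrow> vertex_colors (\<not> right) dz dw q r p"
     "vertex_colors right dx dy p q r \<longleftrightarrow> vertex_colors dx dy right q r p" for p q r
    using flags vertex_colors_rotate by blast+
  have rotated': "vertex_colors dw dx (\<not> up) p q r \<longleftrightarrow> vertex_colors dx (\<not> up) dw q r p" for p q r
    using flags vertex_colors_rotate by blast
  show "rigid (coloring ?T) L (interior ?T)"
    unfolding rigid_def T using assms(6) vertex_colors_unique by simp metis
  show "rigid (coloring ?T') L (interior ?T')"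
    unfolding rigid_def T' rotated using assms(6) vertex_colors_unique by simp metis
  show "extends_over (coloring ?T) (coloring ?T') L"
    unfolding extends_over_def T T'
  proof (intro allI impI)
    fix c :: "nat \<Rightarrow> 'x"
    assume "vertex_colors dw dx (\<not> up) (c w) (c x) (c k) \<and> vertex_colors up dy dz (c k) (c y) (c z)"
    then obtain q where "vertex_colors dw (\<not> right) dz (c w) q (c z)" "vertex_colors right dx dy q (c x) (c y)"
      using IH_colors[OF flags] by blast
    then show "\<exists>c'. (vertex_colors dw (\<not> right) dz (c' w) (c' k) (c' z) \<and>
      vertex_colors right dx dy (c' k) (c' x) (c' y)) \<and> (\<forall>e\<in>L. c' e = c e)"
      using assms(5,6) by (intro exI[of _ "c(k := q)"]) auto
  qed
  show "extends_over (coloring ?T') (coloring ?T) L"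
    unfolding extends_over_def T T'
  proof (intro allI impI)
    fix c :: "nat \<Rightarrow> 'x"
    assume c: "vertex_colors dw (\<not> right) dz (c w) (c k) (c z) \<and> vertex_colors right dx dy (c k) (c x) (c y)"
    have flags': "no_source_sink dx dy (\<not> \<not> right)" "no_source_sink (\<not> right) dz dw"
        "no_source_sink dx (\<not> up) dw" "no_source_sink up dy dz"
      using flags unfolding no_source_sink_def by auto
    obtain q where "vertex_colors dx (\<not> up) dw (c x) q (c w)" "vertex_colors up dy dz q (c y) (c z)"
      using IH_colors[OF flags', of "c x" "c y" "c k" "c z" "c w"] c unfolding rotated not_not by blast
    then show "\<exists>c'. (vertex_colors dw dx (\<not> up) (c' w) (c' x) (c' k) \<and>
      vertex_colors up dy dz (c' k) (c' y) (c' z)) \<and> (\<forall>e\<in>L. c' e = c e)"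
      using assms(5,6) by (intro exI[of _ "c(k := q)"]) (auto simp: rotated')
  qed
qed

text \<open>The boundary labels lie in \<open>L\<close>, as required by the lemmas on the single moves,
  for one of three reasons. In R1 and R2 the crossingless strands of one side consist of pieces in
  \<open>L\<close>; in a twist one side has no interior; in the other moves the boundary lemmas show
  that they are not interior labels.\<close>

lemma move_exchangeable:
  assumes move: "move_sides T T'"
    and "is_diagram \<Gamma>" "is_glued L N T f \<Gamma>" "is_diagram \<Gamma>'" "is_glued L N T' f' \<Gamma>'"
  shows "exchangeable L T T'"
proof -
  have disjoint: "interior T \<inter> L = {}" "interior T' \<inter> L = {}"
    and thr: "through T \<subseteq> L \<times> L" "through T' \<subseteq> L \<times> L"
    and labels: "(\<Union>n\<in>inner_nodes T. set_node n) \<subseteq> L \<union> interior T"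
      "(\<Union>n\<in>inner_nodes T'. set_node n) \<subseteq> L \<union> interior T'"
    using assms(3,5) unfolding is_glued_def by auto
  have ends: "through T = {} \<Longrightarrow> end_disjoint (inner_nodes T)"
      "through T' = {} \<Longrightarrow> end_disjoint (inner_nodes T')"
    using glued_end_disjoint assms(2-5) by blast+
  note label_simps = set_node_crossing set_node_vertex
  from move show ?thesis
    using disjoint thr labels ends
  proof cases
    case (R1 k h a b da)
    then show ?thesis using disjoint thr R1_exchangeable by simp
  next
    case (R2 a2 b2 h b1 a1 db da a3 b3)
    then show ?thesis using disjoint thr by (simp add: R2_exchangeable)
  next
    case (R3 a2 b2 t2 h' a1 t1 da dt b1 t3 db h a3 b3)
    have "{a1, a3, b1, b3, t1, t3} \<inter> {a2, b2, t2} = {}"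
      using R3 ends by (intro R3_boundary) simp_all
    then have "{a1, a3, b1, b3, t1, t3} \<subseteq> L"
      using labels(1) unfolding R3 by (auto simp: label_simps)
    then show ?thesis using R3 disjoint by (simp add: R3_exchangeable)
  next
    case (twist a2 b2 da db dc h a b c)
    then have "{a, b, c} \<subseteq> L" using labels(2) by (simp add: label_simps)
    then show ?thesis using twist disjoint by (simp add: twist_exchangeable)
  next
    case (pass a2 b2 t2 da db dc h a1 t1 dt b1 t3 c1 c2)
    have "{a1, b1, c1, t1, t3} \<inter> {a2, b2, t2} = {}"
      using pass ends(1) by (intro pass_boundary) simp_all
    then have "{a1, b1, c1, t1, t3} \<subseteq> L"
      using labels(1) unfolding pass by (auto simp: label_simps)
    then show ?thesis using pass disjoint by (simp add: pass_exchangeable)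
  next
    case (IH dw dx up dy dz right k w x y z)
    have "k \<notin> {w, x, y, z}"
      using IH_boundary[OF IH(3-6)] ends unfolding IH by simp
    then have "{w, x, y, z} \<subseteq> L"
      using labels(1) unfolding IH by (auto simp: label_simps)
    then show ?thesis using IH disjoint by (simp add: IH_exchangeable)
  qed
qed

end

theorem corollary5p3:
  fixes utri otri mult :: "'x \<Rightarrow> 'x \<Rightarrow> 'x" and D :: "('x \<times> 'x) set"
    and \<Gamma> \<Gamma>' :: diagram
  assumes "partially_multiplicative_biquandle utri otri D mult"
    and "is_diagram \<Gamma>" and "is_diagram \<Gamma>'"
    and "reidemeister_move \<Gamma> \<Gamma>'"
  shows "colorings utri otri D mult \<Gamma> \<approx> colorings utri otri D mult \<Gamma>'"
proof -
  interpret partially_multiplicative_biquandle utri otri D mult by fact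
  obtain L N T T' f f' where move: "move_sides T T' \<or> move_sides T' T"
    and glued: "is_glued L N T f \<Gamma>" "is_glued L N T' f' \<Gamma>'"
    using assms(4) unfolding reidemeister_move_def by blast
  have "exchangeable L T T'"
    using move move_exchangeable same_boundary_colorings_sym glued assms(2,3) by metis
  then show ?thesis
    using colorings_eqpoll[OF glued] by blast
qed

end
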